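(* Let $\mathbb{F}\in\{\mathbb{R},\mathbb{C}\}$ and let $A,B\in\mathbb{F}^{n\times n}$ be symmetric (Hermitian if $\mathbb{F}=\mathbb{C}$) matrices with $A$ positive definite. Let $\mu_1\ge\mu_2\ge\dots\ge\mu_n=\mu_{\min}$ be the eigenvalues of the pencil $B-\mu A$. Let $\gamma\in[0,1)$ and let $T\in\mathbb{F}^{n\times n}$ be a symmetric (Hermitian) positive definite matrix such that $$(1-\gamma)(z,T^{-1}z)\le (z,Az)\le(1+\gamma)(z,T^{-1}z)\qquad\text{for all } z\in\mathbb{F}^n.$$ For a nonzero $x\in\mathbb{F}^n$ with $\mu(x)>\mu_{\min}$ define $$x'=x+\frac{1}{\mu(x)-\mu_{\min}}\,T\,(Bx-\mu(x)Ax).$$ If $1\le i\le n-1$ and $\mu_{i+1}<\mu(x)\le\mu_i$, then $\mu(x')\ge\mu(x)$ and $$\frac{\mu_i-\mu(x')}{\mu(x')-\mu_{i+1}}\le\sigma^2\,\frac{\mu_i-\mu(x)}{\mu(x)-\mu_{i+1}},\qquad \sigma=1-(1-\gamma)\frac{\mu_i-\mu_{i+1}}{\mu_i-\mu_{\min}}.$$ Moreover, the convergence factor $\sigma$ cannot be improved in these terms and under these assumptions: for every $\gamma\in[0,1)$, all real numbers $a>b\ge c$, and every $\tau$ with $0\le\tau<1-(1-\gamma)\frac{a-b}{a-c}$, there exist an integer $n\ge2$, an index $i$ with $1\le i\le n-1$, symmetric (Hermitian if $\mathbb{F}=\mathbb{C}$) matrices $A,B\in\mathbb{F}^{n\times n}$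 with $A$ positive definite such that the eigenvalues $\mu_1\ge\dots\ge\mu_n=\mu_{\min}$ of the pencil $B-\mu A$ satisfy $\mu_i=a$, $\mu_{i+1}=b$, $\mu_{\min}=c$, a symmetric (Hermitian) positive definite matrix $T\in\mathbb{F}^{n\times n}$ with $(1-\gamma)(z,T^{-1}z)\le (z,Az)\le(1+\gamma)(z,T^{-1}z)$ for all $z\in\mathbb{F}^n$, and a nonzero $x\in\mathbb{F}^n$ with $\mu_{i+1}<\mu(x)\le\mu_i$, for which, with $x'=x+\frac{1}{\mu(x)-\mu_{\min}}\,T\,(Bx-\mu(x)Ax)$, the inequality $$\frac{\mu_i-\mu(x')}{\mu(x')-\mu_{i+1}}\le\tau^2\,\frac{\mu_i-\mu(x)}{\mu(x)-\mu_{i+1}}$$ fails.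
   Context: $(\cdot,\cdot)$ denotes the standard scalar product on $\mathbb{F}^n$. The Rayleigh quotient is $\mu(x)=\frac{(x,Bx)}{(x,Ax)}$ for $x\ne0$. The eigenvalues of the pencil $B-\mu A$ are the real numbers $\mu$ for which $Bv=\mu Av$ has a nonzero solution $v$, listed with multiplicity in decreasing order; $\mu_{\min}$ is the smallest one. *)

theory Defs
  imports
    "HOL-Analysis.Inner_Product"
    "Jordan_Normal_Form.Matrix_Kernel"
    "Jordan_Normal_Form.Schur_Decomposition"
begin

text \<open>The operations needed to treat \<open>\<real>\<close> and \<open>\<complex>\<close> uniformly; the class is only meant
  for, and only instantiated by, these two types.\<close>

class scalar_field = conjugatable_field + real_field + real_inner

instance real :: scalar_field ..
instance complex :: scalar_field ..

text \<open>\<open>inner 1\<close> is the identity on \<open>real\<close> and \<open>Re\<close> on \<open>complex\<close>. For a Hermitian matrix \<open>M\<close> the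
  scalar product \<open>(z, M z)\<close> is a real element of the field, so taking its real part only changes
  its type.\<close>

definition quad_form :: "'a::scalar_field mat \<Rightarrow> 'a vec \<Rightarrow> real" where
  "quad_form M z = inner 1 (z \<bullet>c (M *\<^sub>v z))"

definition hermitian_mat :: "nat \<Rightarrow> 'a::scalar_field mat \<Rightarrow> bool" where
  "hermitian_mat n M \<longleftrightarrow> M \<in> carrier_mat n n \<and> mat_adjoint M = M"

definition pos_def_mat :: "nat \<Rightarrow> 'a::scalar_field mat \<Rightarrow> bool" where
  "pos_def_mat n M \<longleftrightarrow>
     hermitian_mat n M \<and> (\<forall>z \<in> carrier_vec n. z \<noteq> 0\<^sub>v n \<longrightarrow> 0 < quad_form M z)"

definition rayleigh :: "'a::scalar_field mat \<Rightarrow> 'a mat \<Rightarrow> 'a vec \<Rightarrow> real" where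
  "rayleigh A B x = quad_form B x / quad_form A x"

definition pencil_spectrum :: "'a::scalar_field mat \<Rightarrow> 'a mat \<Rightarrow> real set" where
  "pencil_spectrum A B =
     {\<mu>. \<exists>v \<in> carrier_vec (dim_col A). v \<noteq> 0\<^sub>v (dim_col A) \<and>
          B *\<^sub>v v = of_real \<mu> \<cdot>\<^sub>v (A *\<^sub>v v)}"

text \<open>All eigenvalues of the pencil \<open>B - \<mu> A\<close> in decreasing order, each repeated according to the
  dimension of its eigenspace (for a Hermitian \<open>B\<close> and a positive definite \<open>A\<close> this agrees with the
  multiplicity as a root of \<open>det (B - \<mu> A)\<close>, and the list has length \<open>n\<close>).\<close>

definition pencil_eigvals :: "'a::scalar_field mat \<Rightarrow> 'a mat \<Rightarrow> real list" where
  "pencil_eigvals A B =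
     concat (map (\<lambda>\<mu>. replicate (kernel_dim (B - of_real \<mu> \<cdot>\<^sub>m A)) \<mu>)
       (rev (sorted_list_of_set (pencil_spectrum A B))))"

text \<open>Eigenvalues are numbered from 1.\<close>

definition pencil_eigval :: "'a::scalar_field mat \<Rightarrow> 'a mat \<Rightarrow> nat \<Rightarrow> real" where
  "pencil_eigval A B i = pencil_eigvals A B ! (i - 1)"

definition mu_min :: "'a::scalar_field mat \<Rightarrow> 'a mat \<Rightarrow> real" where
  "mu_min A B = Min (pencil_spectrum A B)"

text \<open>A positive definite \<open>T\<close> is invertible, so \<open>the\<close> is applied to a \<open>Some\<close> here.\<close>

definition preconditioner :: "nat \<Rightarrow> real \<Rightarrow> 'a::scalar_field mat \<Rightarrow> 'a mat \<Rightarrow> bool" where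
  "preconditioner n \<gamma> A T \<longleftrightarrow>
     pos_def_mat n T \<and>
     (\<forall>z \<in> carrier_vec n.
        (1 - \<gamma>) * quad_form (the (mat_inverse T)) z \<le> quad_form A z \<and>
        quad_form A z \<le> (1 + \<gamma>) * quad_form (the (mat_inverse T)) z)"

definition prec_step :: "'a::scalar_field mat \<Rightarrow> 'a mat \<Rightarrow> 'a mat \<Rightarrow> 'a vec \<Rightarrow> 'a vec" where
  "prec_step A B T x =
     x + of_real (1 / (rayleigh A B x - mu_min A B)) \<cdot>\<^sub>v
           (T *\<^sub>v (B *\<^sub>v x - of_real (rayleigh A B x) \<cdot>\<^sub>v (A *\<^sub>v x)))"

end

theory Submission
  imports Defs
    "Jordan_Normal_Form.Spectral_Radius"
    "Jordan_Normal_Form.Jordan_Normal_Form_Uniqueness"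
begin

text \<open>An \<open>A\<close>-orthonormal basis of eigenvectors of the pencil (\<open>pencil_diagonalizable\<close>) turns \<open>A\<close>
into the identity and \<open>B\<close> into a diagonal matrix with entries \<open>\<lambda>\<^sub>j\<close>. Subtracting \<open>\<mu>\<^sub>m\<^sub>i\<^sub>n A\<close> from \<open>B\<close>
shifts all Rayleigh quotients by the same amount and leaves \<open>x'\<close> and both fractions unchanged, so one
may think of \<open>\<mu>\<^sub>m\<^sub>i\<^sub>n = 0\<close>. Write \<open>a = \<mu>\<^sub>i\<close>, \<open>b = \<mu>\<^sub>i\<^sub>+\<^sub>1\<close>, \<open>\<kappa> = \<mu>(x)\<close>. The hypothesis on \<open>T\<close> says that
\<open>I - T A\<close> has \<open>A\<close>-norm at most \<open>\<gamma>\<close> (\<open>preconditioner_ball\<close>). Hence the vector \<open>y = \<kappa> x'\<close>, which has the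
same Rayleigh quotient as \<open>x'\<close>, satisfies \<open>\<parallel>y - Bx\<parallel> \<le> \<gamma> \<parallel>Bx - \<kappa> x\<parallel>\<close>: all that matters about \<open>T\<close> is
that \<open>y\<close> lies in this ball.

Let \<open>\<kappa>'\<close> be the number for which the claimed estimate with \<open>\<mu>(x')\<close> replaced by \<open>\<kappa>'\<close> is an equality. The
task is to show \<open>(y, (B - \<kappa>') y) \<ge> 0\<close> for all \<open>y\<close> in the ball and all \<open>x\<close> with \<open>(x, (B - \<kappa>) x) = 0\<close>.
The proof exhibits multipliers \<open>s > 0\<close> and \<open>m\<close> with
\<open>(y, (B - \<kappa>') y) + s (\<parallel>y - Bx\<parallel>\<^sup>2 - \<gamma>\<^sup>2 \<parallel>Bx - \<kappa> x\<parallel>\<^sup>2) - m (x, (B - \<kappa>) x) \<ge> 0\<close>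
for all vectors \<open>x\<close> and \<open>y\<close> whatsoever. In the eigenbasis this quadratic form splits into one
binary form per eigenvalue \<open>\<lambda>\<close>, and what has to be checked is that its determinant, a cubic polynomial
\<open>D(\<lambda>)\<close>, is nonnegative on the spectrum. The spectrum lies in \<open>[0, b] \<union> [a, \<infinity>)\<close>, and the signs
of \<open>D\<close> at \<open>0\<close>, \<open>b\<close>, \<open>\<kappa>\<close> and \<open>a\<close> determine it there (\<open>block_determinant_nonneg\<close>,
\<open>certificate_sum\<close>). The choice of \<open>s\<close> divides by \<open>\<gamma>\<close>, and \<open>\<gamma> = 0\<close> follows by letting the radius of
the ball shrink (\<open>certificate_bound\<close>).

For the sharpness, take the plane spanned by two eigenvectors for \<open>a\<close> and \<open>b\<close> and the preconditioner
\<open>T = (1 - \<gamma>) A\<^sup>-\<^sup>1\<close>. Then the square root of the quotient \<open>(a - \<mu>) / (\<mu> - b)\<close> is the ratio of the two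
components, and one step multiplies it by a factor that tends to \<open>\<sigma>\<close> as \<open>x\<close> approaches the eigenvector
for \<open>a\<close> (\<open>convergence_factor_sharp\<close>).\<close>

section \<open>Real and complex scalars\<close>

text \<open>The common properties of the two scalar fields, so that every argument is carried out once for both.
The embedding into \<open>\<complex>\<close> is there to obtain eigenvalues: a real symmetric matrix is regarded as a
Hermitian matrix, which has an eigenvalue by the fundamental theorem of algebra.\<close>

class real_or_complex = scalar_field +
  assumes conjugate_scaleR_1: "conjugate (r *\<^sub>R 1) = r *\<^sub>R 1"
    and mult_conjugate_inner: "x * conjugate x = inner x x *\<^sub>R 1"
    and conjugate_fixed_inner: "conjugate x = x \<Longrightarrow> x = inner 1 x *\<^sub>R 1"
    and complex_embedding_scaleR: "\<exists>h :: 'a \<Rightarrow> complex. h 1 = 1 \<and> (\<forall>x y. h (x + y) = h x + h y) \<and>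
      (\<forall>x y. h (x * y) = h x * h y) \<and> (\<forall>x. h (conjugate x) = cnj (h x)) \<and>
      (\<forall>r. h (r *\<^sub>R 1) = complex_of_real r)"

instance real :: real_or_complex
proof
  show "\<exists>h :: real \<Rightarrow> complex. h 1 = 1 \<and> (\<forall>x y. h (x + y) = h x + h y) \<and>
      (\<forall>x y. h (x * y) = h x * h y) \<and> (\<forall>x. h (conjugate x) = cnj (h x)) \<and>
      (\<forall>r. h (r *\<^sub>R 1) = complex_of_real r)"
    by (rule exI[of _ complex_of_real]) simp
qed simp_all

instance complex :: real_or_complex
proof
  show "\<exists>h :: complex \<Rightarrow> complex. h 1 = 1 \<and> (\<forall>x y. h (x + y) = h x + h y) \<and>
      (\<forall>x y. h (x * y) = h x * h y) \<and> (\<forall>x. h (conjugate x) = cnj (h x)) \<and>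
      (\<forall>r. h (r *\<^sub>R 1) = complex_of_real r)"
    by (rule exI[of _ "\<lambda>x. x"]) (simp add: complex_eq_iff)
qed (auto simp: complex_eq_iff inner_complex_def)

lemma conjugate_of_real: "conjugate (of_real r :: 'a::real_or_complex) = of_real r"
  by (simp add: of_real_def conjugate_scaleR_1)

lemma mult_conjugate: "x * conjugate x = (of_real ((norm x)\<^sup>2) :: 'a::real_or_complex)"
  by (simp add: of_real_def mult_conjugate_inner power2_norm_eq_inner del: of_real_power)

lemma conjugate_fixed: "conjugate x = x \<Longrightarrow> x = (of_real (inner 1 x) :: 'a::real_or_complex)"
  by (simp add: of_real_def conjugate_fixed_inner[symmetric])

lemma complex_embedding:
  obtains h :: "'a::real_or_complex \<Rightarrow> complex" where "h 1 = 1" "\<And>x y. h (x + y) = h x + h y"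
    "\<And>x y. h (x * y) = h x * h y" "\<And>x. h (conjugate x) = cnj (h x)"
    "\<And>r. h (of_real r) = complex_of_real r"
  using complex_embedding_scaleR[where 'a='a] unfolding of_real_def by blast

lemma inner_one_of_real: "inner 1 (of_real r :: 'a::real_or_complex) = r"
proof -
  have "conjugate (1::'a) = 1" using conjugate_of_real[of 1, where 'a='a] by simp
  hence "of_real (inner 1 (1::'a)) = (of_real 1 :: 'a)" using mult_conjugate[of "1::'a"]
    by (simp add: power2_norm_eq_inner del: of_real_power norm_one)
  hence "inner 1 (1::'a) = 1"
    by (metis of_real_1 of_real_eq_iff power2_norm_eq_inner)
  thus ?thesis by (simp add: of_real_def)
qed

lemma norm_of_real_eq [simp]: "norm (of_real r :: 'a::real_or_complex) = \<bar>r\<bar>"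
proof -
  have "(norm (1::'a))\<^sup>2 = 1" using inner_one_of_real[of 1, where 'a='a] by (simp add: power2_norm_eq_inner)
  hence "norm (1::'a) = 1" using norm_ge_zero[of "1::'a"] by (simp add: power2_eq_1_iff)
  thus ?thesis by (simp add: of_real_def)
qed

lemma conjugate_one [simp]: "conjugate (1 :: 'a::conjugatable_field) = 1"
proof -
  have "conjugate (1::'a) * conjugate 1 = conjugate 1 * 1"
    using conjugate_dist_mul[of "1::'a" 1] by simp
  thus ?thesis by (simp only: mult_cancel_left conjugate_zero_iff) simp
qed

section \<open>The multiplier certificate\<close>

text \<open>Convexity, in the form of the three-point identity in the proof.\<close>

lemma convex_quadratic_nonpos:
  fixes E0 E1 E2 b x :: real
  assumes "E2 > 0" "E0 + E1*b + E2*b\<^sup>2 \<le> 0" "E0 \<le> 0" "0 \<le> x" "x \<le> b"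
  shows "E0 + E1*x + E2*x\<^sup>2 \<le> 0"
proof (cases "b = 0")
  case False
  hence b: "b > 0" using assms by linarith
  have "b * (E0 + E1*x + E2*x\<^sup>2) = (b - x) * E0 + x * (E0 + E1*b + E2*b\<^sup>2) - E2*b*x*(b-x)"
    by (simp add: field_simps power2_eq_square)
  also have "\<dots> \<le> 0"
  proof -
    have "(b - x) * E0 \<le> 0" "x * (E0 + E1*b + E2*b\<^sup>2) \<le> 0" "E2*b*x*(b-x) \<ge> 0"
      using assms b by (simp_all add: mult_nonneg_nonpos)
    thus ?thesis by linarith
  qed
  finally show ?thesis using b by (simp add: mult_le_0_iff)
qed (use assms in auto)

text \<open>The determinant \<open>D\<close> of the binary form attached to an eigenvalue \<open>x\<close>, for a pencil whose smallest
eigenvalue is \<open>0\<close>; \<open>k\<close> is the Rayleigh quotient before the step and \<open>b + q\<close> the bound claimed after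
it, and the equation \<open>p Q = \<sigma>\<^sup>2 P q\<close> says that this bound corresponds to the factor \<open>\<sigma>\<^sup>2\<close>.

For \<open>k < a\<close>, the multiplier \<open>m\<close> is the largest one compatible with the eigenvalue \<open>a\<close>, so \<open>D\<close>
vanishes there. The eigenvalue \<open>b\<close> imposes a lower bound on \<open>m\<close>. With \<open>u = s - q\<close> and \<open>d = a - b\<close>, the two bounds are
compatible precisely when \<open>(\<gamma> u - b)\<^sup>2 \<le> \<gamma>\<^sup>2 (1 - Q / q) u (u + d)\<close>. As \<open>Q \<le> q\<close>, the choice
\<open>u = b / \<gamma>\<close>, which makes the left-hand side vanish, always works. The rest is a
sign count: \<open>D\<close> has positive leading coefficient, is nonnegative at \<open>0\<close> and \<open>b\<close>, nonpositive at \<open>k\<close>,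
and zero at \<open>a\<close>.\<close>

lemma block_determinant_nonneg:
  fixes a b k \<gamma> \<sigma> q s m x P Q p :: real
  defines "s \<equiv> q + b/\<gamma>" and "P \<equiv> a - k" and "Q \<equiv> k - b" and "p \<equiv> a - b - q"
  defines "m \<equiv> s * (a\<^sup>2 * \<sigma>\<^sup>2 * q / Q / (p + s) - \<gamma>\<^sup>2 * P)"
  defines "D \<equiv> \<lambda>x. (x - (b+q)) * (s * x\<^sup>2) - (x - (b+q) + s) * (x - k) * (s*\<gamma>\<^sup>2*(x-k) + m)"
  assumes "0 < \<gamma>" "\<gamma> < 1" "0 \<le> b" "b < k" "k \<le> a"
    and sig: "a * \<sigma> = \<gamma> * a + (1-\<gamma>)*b"
    and pq: "p * Q = \<sigma>\<^sup>2 * P * q" and "Q \<le> q" "0 \<le> p"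
    and x: "0 \<le> x" "x \<le> b \<or> a \<le> x"
  shows "0 \<le> D x" and "s * \<gamma>\<^sup>2 * k \<le> m"
proof -
  have pos1: "P \<ge> 0" "Q > 0" "q > 0" "a > 0" "k > 0" "b / \<gamma> \<ge> 0"
    using assms(6-) by (auto simp: P_def Q_def)
  hence pos: "P \<ge> 0" "Q > 0" "q > 0" "s > 0" "p + s > 0" "a > 0" "k > 0"
    using \<open>0 \<le> p\<close> unfolding s_def by linarith+
  define d where "d = a - b"
  have d: "P + Q = d" "p + q = d" "d > 0" using assms(6-) by (auto simp: d_def P_def Q_def p_def)
  define u where "u = b / \<gamma>"
  have u: "u \<ge> 0" "\<gamma> * u = b" "s = q + u" using assms(6-) by (auto simp: u_def s_def)
  have Da: "D a = 0"
  proof -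
    have 1: "a - (b+q) = p" "a - (b+q) + s = p + s" by (auto simp: p_def)
    have 2: "(p+s) * (s*\<gamma>\<^sup>2*P + m) = s * a\<^sup>2 * \<sigma>\<^sup>2 * q / Q"
    proof -
      have "s*\<gamma>\<^sup>2*P + m = s * (a\<^sup>2 * \<sigma>\<^sup>2 * q / Q / (p + s))" by (simp add: m_def algebra_simps)
      thus ?thesis using pos by simp
    qed
    have "D a = p * (s * a\<^sup>2) - P * ((p+s) * (s*\<gamma>\<^sup>2*P + m))"
      unfolding D_def 1 P_def[symmetric] by (simp add: algebra_simps)
    also have "\<dots> = s * a\<^sup>2 * (p - \<sigma>\<^sup>2 * P * q / Q)" unfolding 2 using pos by (simp add: field_simps)
    also have "p = \<sigma>\<^sup>2 * P * q / Q" using pq pos by (simp add: field_simps)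
    finally show ?thesis by simp
  qed
  have as: "a\<^sup>2 * \<sigma>\<^sup>2 = (b + \<gamma> * d)\<^sup>2"
  proof -
    have "a * \<sigma> = b + \<gamma> * d" using sig by (simp add: d_def algebra_simps)
    thus ?thesis by (metis power_mult_distrib)
  qed
  \<comment> \<open>the lower bound imposed by \<open>b\<close>; the factor \<open>q - Q\<close> in its proof is where \<open>u = b / \<gamma>\<close> pays off\<close>
  have m1: "s * (\<gamma> * b * q / Q + \<gamma>\<^sup>2 * Q) \<le> m"
  proof -
    have ps: "p + s = d + u" using d u by simp
    have "(\<gamma> * b * q + \<gamma>\<^sup>2 * d * Q) * (d + u) \<le> (b + \<gamma> * d)\<^sup>2 * q"
    proof -
      have "(b + \<gamma> * d)\<^sup>2 * q - (\<gamma> * b * q + \<gamma>\<^sup>2 * d * Q) * (d + u) = \<gamma>\<^sup>2 * d * (d+u) * (q - Q)"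
        unfolding u(2)[symmetric] by (simp add: algebra_simps power2_eq_square)
      also have "\<dots> \<ge> 0" using assms(6-) d u by simp
      finally show ?thesis by simp
    qed
    hence "\<gamma> * b * q + \<gamma>\<^sup>2 * d * Q \<le> (b + \<gamma> * d)\<^sup>2 * q / (d+u)"
      using d u by (simp add: pos_le_divide_eq)
    hence "(\<gamma> * b * q + \<gamma>\<^sup>2 * d * Q) / Q \<le> (b + \<gamma> * d)\<^sup>2 * q / (d+u) / Q"
      using pos by (intro divide_right_mono) auto
    hence "\<gamma> * b * q / Q + \<gamma>\<^sup>2 * d \<le> (b + \<gamma> * d)\<^sup>2 * q / Q / (d+u)"
      using pos by (simp add: add_divide_distrib divide_divide_eq_left mult.commute[of "d+u" Q])
    moreover have "\<gamma>\<^sup>2 * d = \<gamma>\<^sup>2 * P + \<gamma>\<^sup>2 * Q" unfolding d(1)[symmetric] by (rule distrib_left)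
    ultimately have "\<gamma> * b * q / Q + \<gamma>\<^sup>2 * Q \<le> a\<^sup>2 * \<sigma>\<^sup>2 * q / Q / (p + s) - \<gamma>\<^sup>2 * P"
      unfolding ps as by linarith
    thus ?thesis unfolding m_def using pos by simp
  qed
  have bk: "\<gamma> * b \<le> \<gamma> * b * q / Q"
  proof -
    have "\<gamma> * b * Q \<le> \<gamma> * b * q" using assms(6-) by (intro mult_left_mono) auto
    thus ?thesis using pos by (simp add: pos_le_divide_eq)
  qed
  show mk: "s * \<gamma>\<^sup>2 * k \<le> m"
  proof -
    have "\<gamma>\<^sup>2 * b \<le> \<gamma> * b" using assms(6-) by (intro mult_right_mono) (auto simp: power2_eq_square)
    hence "\<gamma>\<^sup>2 * k \<le> \<gamma> * b * q / Q + \<gamma>\<^sup>2 * Q" using bk by (simp add: Q_def algebra_simps)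
    hence "s * (\<gamma>\<^sup>2 * k) \<le> s * (\<gamma> * b * q / Q + \<gamma>\<^sup>2 * Q)" using pos by (intro mult_left_mono) auto
    thus ?thesis using m1 by (simp add: mult.assoc)
  qed
  have Db: "D b \<ge> 0"
  proof -
    have "D b = - q * s * b\<^sup>2 + u * Q * (m - s*\<gamma>\<^sup>2*Q)" by (simp add: D_def Q_def u algebra_simps)
    moreover have "u * Q * (m - s*\<gamma>\<^sup>2*Q) \<ge> u * Q * (s * (\<gamma> * b * q / Q))"
      using m1 pos u by (intro mult_left_mono) (auto simp: algebra_simps)
    moreover have "u * Q * (s * (\<gamma> * b * q / Q)) = (\<gamma> * u) * b * q * s" using pos by simp
    ultimately show ?thesis unfolding u(2) by (simp add: power2_eq_square algebra_simps)
  qed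
  have D0: "D 0 \<ge> 0"
  proof -
    have "D 0 = (u - b) * k * (m - s*\<gamma>\<^sup>2*k)" by (simp add: D_def u algebra_simps)
    moreover have "u \<ge> b" using assms(6-) u by (metis mult_left_le_one_le less_imp_le)
    ultimately show ?thesis using mk pos by simp
  qed
  have Dk: "D k \<le> 0"
  proof -
    have "D k = - ((q - Q) * (s * k\<^sup>2))" by (simp add: D_def Q_def algebra_simps)
    moreover have "0 \<le> (q - Q) * (s * k\<^sup>2)"
      using \<open>Q \<le> q\<close> pos by (intro mult_nonneg_nonneg) auto
    ultimately show ?thesis by linarith
  qed
  \<comment> \<open>dividing by the root \<open>a\<close> leaves a convex quadratic \<open>E\<close>, whose sign at three points is known\<close>
  define c3 where "c3 = s * (1 - \<gamma>\<^sup>2)"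
  have c3: "c3 > 0" using pos assms(6-) by (simp add: c3_def abs_square_less_1)
  define c2 where "c2 = - s*(b+q) - m + 2*s*\<gamma>\<^sup>2*k - (s - (b+q))*s*\<gamma>\<^sup>2"
  define c1 where "c1 = - (s-(b+q))*m + 2*(s-(b+q))*s*\<gamma>\<^sup>2*k + m*k - s*\<gamma>\<^sup>2*k\<^sup>2"
  define c0 where "c0 = (s-(b+q)) * k * (m - s*\<gamma>\<^sup>2*k)"
  have Dx: "D x = c3*x^3 + c2*x\<^sup>2 + c1*x + c0" for x
    by (simp add: D_def c3_def c2_def c1_def c0_def algebra_simps power2_eq_square power3_eq_cube)
  define E where "E = (\<lambda>x. (c1 + c2*a + c3*a\<^sup>2) + (c2 + c3*a)*x + c3*x\<^sup>2)"
  have DE: "D x = (x - a) * E x" for x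
  proof -
    have "D x = D x - D a" using Da by simp
    also have "\<dots> = (x - a) * E x" unfolding Dx E_def
      by (simp add: algebra_simps power2_eq_square power3_eq_cube)
    finally show ?thesis .
  qed
  have ba: "b < a" using assms(6-) by linarith
  have Eb: "E b \<le> 0" using Db DE[of b] ba by (simp add: zero_le_mult_iff)
  have E0: "E 0 \<le> 0" using D0 DE[of 0] pos by (simp add: mult_le_0_iff)
  have Ele: "E y \<le> 0" if "0 \<le> y" "y \<le> b" for y
    using convex_quadratic_nonpos[OF c3, of "c1 + c2*a + c3*a\<^sup>2" "c2 + c3*a" b y] Eb E0 that by (simp add: E_def)
  show "0 \<le> D x"
  proof (cases "x \<le> b")
    case True
    thus ?thesis using Ele[of x] x DE[of x] ba by (simp add: zero_le_mult_iff)
  next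
    case False
    hence xa: "a \<le> x" using x by simp
    have Ek: "E k \<ge> 0"
    \<comment> \<open>for \<open>k = a\<close> the root \<open>a\<close> of \<open>D\<close> is trivial, and \<open>E a\<close> has to be found from the derivative\<close>
    proof (cases "k = a")
      case True
      hence "P = 0" "p = 0" using pq pos by (auto simp: P_def)
      hence ab: "b + q = a" "q = Q" "p = 0" using True by (auto simp: p_def Q_def)
      have "E a = c1 + 2*c2*a + 3*c3*a\<^sup>2" by (simp add: E_def power2_eq_square algebra_simps)
      also have "\<dots> = s * (a\<^sup>2 - m)"
        unfolding c1_def c2_def c3_def ab(1) True by (simp add: power2_eq_square algebra_simps)
      also have "m = a\<^sup>2 * \<sigma>\<^sup>2" using \<open>P = 0\<close> ab pos by (simp add: m_def)
      also have "s * (a\<^sup>2 - a\<^sup>2 * \<sigma>\<^sup>2) \<ge> 0"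
      proof -
        have "\<gamma> * d \<le> d" using d(3) \<open>\<gamma> < 1\<close> by simp
        hence "b + \<gamma> * d \<le> a" unfolding d_def by linarith
        have "0 \<le> b + \<gamma> * d" using \<open>0 \<le> b\<close> \<open>0 < \<gamma>\<close> d(3) by simp
        with \<open>b + \<gamma> * d \<le> a\<close> have "(b + \<gamma> * d)\<^sup>2 \<le> a\<^sup>2" by (intro power_mono)
        thus ?thesis unfolding as using pos by simp
      qed
      finally show ?thesis using True by simp
    next
      case False
      moreover have "(k - a) * E k \<le> 0" using Dk unfolding DE[of k] .
      ultimately show ?thesis using \<open>k \<le> a\<close> by (simp add: mult_le_0_iff)
    qed
    have "x * E k = (x - k) * E 0 + k * E x - c3 * x * k * (x - k)"
      by (simp add: E_def algebra_simps power2_eq_square)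
    moreover have "(x - k) * E 0 \<le> 0" "x * E k \<ge> 0" "c3 * x * k * (x - k) \<ge> 0"
      using E0 Ek xa assms(6-) pos c3 by (auto simp: mult_nonneg_nonpos)
    ultimately have "k * E x \<ge> 0" by linarith
    hence "E x \<ge> 0" using pos by (simp add: zero_le_mult_iff)
    thus ?thesis using xa DE[of x] by simp
  qed
qed

text \<open>The sum of the nonnegative binary forms, in which \<open>ball\<close>, an inequality, enters with the positive
weight \<open>s\<close>, and \<open>mean\<close>, an equality, with the weight \<open>m\<close>.\<close>

lemma certificate_sum:
  fixes lam f g :: "nat \<Rightarrow> real" and a b k \<gamma> \<sigma> q :: real
  assumes "0 < \<gamma>" "\<gamma> < 1" "0 \<le> b" "b < k" "k \<le> a"
    and sig: "a * \<sigma> = \<gamma> * a + (1-\<gamma>)*b"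
    and pq: "(a - b - q) * (k - b) = \<sigma>\<^sup>2 * (a - k) * q" and q: "k - b \<le> q" "0 \<le> a - b - q"
    and lam: "\<And>j. j < n \<Longrightarrow> 0 \<le> lam j \<and> (lam j \<le> b \<or> a \<le> lam j)"
    and mean: "(\<Sum>j<n. (lam j - k) * (f j)\<^sup>2) = 0"
    and ball: "(\<Sum>j<n. (g j - lam j * f j)\<^sup>2) \<le> \<gamma>\<^sup>2 * (\<Sum>j<n. ((lam j - k) * f j)\<^sup>2)"
  shows "0 \<le> (\<Sum>j<n. (lam j - (b + q)) * (g j)\<^sup>2)"
proof -
  define s where "s = q + b/\<gamma>"
  define m where "m = s * (a\<^sup>2 * \<sigma>\<^sup>2 * q / (k - b) / (a - b - q + s) - \<gamma>\<^sup>2 * (a - k))"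
  have bg: "b \<le> b / \<gamma>" using assms(1-3) mult_left_mono[of \<gamma> 1 b] by (simp add: pos_le_divide_eq)
  have s0: "s > 0" using q assms(3,4) bg unfolding s_def by linarith
  have block: "0 \<le> (lam j - (b+q)) * (g j)\<^sup>2 + s * ((g j - lam j * f j)\<^sup>2 - \<gamma>\<^sup>2 * ((lam j - k) * f j)\<^sup>2)
      - m * ((lam j - k) * (f j)\<^sup>2)" (is "0 \<le> ?X") if j: "j < n" for j
  proof -
    define l where "l = lam j"
    have l: "0 \<le> l" "l \<le> b \<or> a \<le> l" using lam[OF j] by (auto simp: l_def)
    note D = block_determinant_nonneg[OF assms(1-9) l, folded s_def, folded m_def]
    define Y where "Y = l - (b+q) + s"
    \<comment> \<open>completing the square in \<open>g j\<close>; \<open>Y\<close> vanishes only if \<open>b = 0\<close> and \<open>l = 0\<close>\<close>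
    have "Y * ?X = (Y * g j - s * l * f j)\<^sup>2 + ((l - (b + q)) * (s * l\<^sup>2) -
       Y * (l - k) * (s * \<gamma>\<^sup>2 * (l - k) + m)) * (f j)\<^sup>2"
      unfolding Y_def l_def by (simp add: algebra_simps power2_eq_square)
    also have "\<dots> \<ge> 0" using D(1) unfolding Y_def by simp
    finally have YX: "Y * ?X \<ge> 0" .
    have "Y \<ge> l" using bg by (simp add: Y_def s_def)
    show ?thesis
    proof (cases "Y = 0")
      case True
      hence "l = 0" using \<open>Y \<ge> l\<close> l by simp
      hence "s = b + q" using True by (simp add: Y_def)
      have "?X = k * (m - s*\<gamma>\<^sup>2*k) * (f j)\<^sup>2"
        using \<open>l = 0\<close> \<open>s = b + q\<close> by (simp add: l_def algebra_simps power2_eq_square)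
      also have "\<dots> \<ge> 0" using D(2) assms(3,4) by simp
      finally show ?thesis .
    next
      case False
      hence "Y > 0" using \<open>Y \<ge> l\<close> l by linarith
      thus ?thesis using YX by (simp add: zero_le_mult_iff)
    qed
  qed
  have "0 \<le> (\<Sum>j<n. (lam j - (b+q)) * (g j)\<^sup>2 + s * ((g j - lam j * f j)\<^sup>2 - \<gamma>\<^sup>2 * ((lam j - k) * f j)\<^sup>2)
      - m * ((lam j - k) * (f j)\<^sup>2))"
    using block by (intro sum_nonneg) auto
  also have "\<dots> = (\<Sum>j<n. (lam j - (b+q)) * (g j)\<^sup>2) +
      s * ((\<Sum>j<n. (g j - lam j * f j)\<^sup>2) - \<gamma>\<^sup>2 * (\<Sum>j<n. ((lam j - k) * f j)\<^sup>2))
      - m * (\<Sum>j<n. (lam j - k) * (f j)\<^sup>2)"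
    by (simp add: sum.distrib sum_subtractf sum_distrib_left right_diff_distrib)
  also have "\<dots> \<le> (\<Sum>j<n. (lam j - (b+q)) * (g j)\<^sup>2)"
    using ball s0 by (simp add: mean mult_nonneg_nonpos)
  finally show ?thesis .
qed

text \<open>The equation between \<open>q\<close> and \<open>\<sigma>\<close> solved for \<open>q\<close>, and the case \<open>\<gamma> = 0\<close> added: a ball
of radius \<open>0\<close> lies in every larger one, and the bound is continuous in \<open>\<gamma>\<close>.\<close>

lemma certificate_bound:
  fixes lam f g :: "nat \<Rightarrow> real" and a b k \<gamma> :: real
  defines "\<sigma> \<equiv> \<gamma> + (1-\<gamma>) * (b/a)"
  assumes "0 \<le> \<gamma>" "\<gamma> < 1" "0 \<le> b" "b < k" "k \<le> a"
    and lam: "\<And>j. j < n \<Longrightarrow> 0 \<le> lam j \<and> (lam j \<le> b \<or> a \<le> lam j)"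
    and mean: "(\<Sum>j<n. (lam j - k) * (f j)\<^sup>2) = 0"
    and ball: "(\<Sum>j<n. (g j - lam j * f j)\<^sup>2) \<le> \<gamma>\<^sup>2 * (\<Sum>j<n. ((lam j - k) * f j)\<^sup>2)"
  shows "0 \<le> (\<Sum>j<n. (lam j - (b + (a-b)*(k-b)/((k-b) + \<sigma>\<^sup>2*(a-k)))) * (g j)\<^sup>2)"
proof -
  define S where "S = (\<lambda>\<gamma>. \<gamma> + (1-\<gamma>) * (b/a))"
  define q where "q = (\<lambda>\<gamma>. (a-b)*(k-b)/((k-b) + (S \<gamma>)\<^sup>2*(a-k)))"
  have a0: "a > 0" using assms by linarith
  have den: "(k-b) + (S \<gamma>)\<^sup>2*(a-k) > 0" for \<gamma>
    using assms(5,6) by (intro add_pos_nonneg) auto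
  have pos_case: "0 \<le> (\<Sum>j<n. (lam j - (b + q \<delta>)) * (g j)\<^sup>2)" if \<delta>: "0 < \<delta>" "\<delta> < 1" "\<gamma> \<le> \<delta>" for \<delta>
  proof (rule certificate_sum[OF \<delta>(1,2) assms(4-6), where \<sigma>="S \<delta>" and f=f])
    show "a * S \<delta> = \<delta> * a + (1 - \<delta>) * b" using a0 by (simp add: S_def field_simps)
    have q: "q \<delta> * ((k-b) + (S \<delta>)\<^sup>2*(a-k)) = (a-b)*(k-b)"
      using den[of \<delta>] by (simp add: q_def)
    show "(a - b - q \<delta>) * (k - b) = (S \<delta>)\<^sup>2 * (a - k) * q \<delta>" using q by (simp add: algebra_simps)
    have "0 \<le> S \<delta>" "S \<delta> \<le> 1"
    proof -
      have "0 \<le> b/a" "b/a \<le> 1" using assms a0 by auto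
      thus "0 \<le> S \<delta>" using \<delta> unfolding S_def by (intro add_nonneg_nonneg mult_nonneg_nonneg) auto
      show "S \<delta> \<le> 1" using mult_left_mono[OF \<open>b/a \<le> 1\<close>, of "1-\<delta>"] \<delta> by (simp add: S_def)
    qed
    hence S1: "(S \<delta>)\<^sup>2 \<le> 1" by (simp add: power_le_one)
    hence le: "(k-b) + (S \<delta>)\<^sup>2*(a-k) \<le> a - b" using mult_right_mono[OF S1, of "a-k"] assms by simp
    have "(k - b) * ((k-b) + (S \<delta>)\<^sup>2*(a-k)) \<le> (k-b) * (a - b)" using le assms by (intro mult_left_mono) auto
    thus "k - b \<le> q \<delta>" unfolding q_def using den[of \<delta>] by (simp add: pos_le_divide_eq mult.commute)
    have "(a-b)*(k-b) \<le> (a-b) * ((k-b) + (S \<delta>)\<^sup>2*(a-k))" using assms by (intro mult_left_mono) auto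
    thus "0 \<le> a - b - q \<delta>" unfolding q_def using den[of \<delta>] by (simp add: pos_divide_le_eq)
    show "(\<Sum>j<n. (g j - lam j * f j)\<^sup>2) \<le> \<delta>\<^sup>2 * (\<Sum>j<n. ((lam j - k) * f j)\<^sup>2)"
    proof (rule order_trans[OF ball])
      show "\<gamma>\<^sup>2 * (\<Sum>j<n. ((lam j - k) * f j)\<^sup>2) \<le> \<delta>\<^sup>2 * (\<Sum>j<n. ((lam j - k) * f j)\<^sup>2)"
        using assms(2) \<delta> by (intro mult_right_mono power_mono sum_nonneg) auto
    qed
  qed (use lam mean in auto)
  have "0 \<le> (\<Sum>j<n. (lam j - (b + q \<gamma>)) * (g j)\<^sup>2)"
  proof (cases "\<gamma> = 0")
    case False
    thus ?thesis using pos_case[of \<gamma>] assms by simp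
  next
    case True
    have "isCont (\<lambda>\<delta>. (\<Sum>j<n. (lam j - (b + q \<delta>)) * (g j)\<^sup>2)) 0"
      unfolding q_def S_def using den[of 0, unfolded S_def] by (intro continuous_intros) auto
    hence "((\<lambda>\<delta>. (\<Sum>j<n. (lam j - (b + q \<delta>)) * (g j)\<^sup>2)) \<longlongrightarrow> (\<Sum>j<n. (lam j - (b + q 0)) * (g j)\<^sup>2)) (at_right 0)"
      unfolding isCont_def by (rule tendsto_within_subset) simp
    moreover have "eventually (\<lambda>\<delta>. \<delta> \<in> {0<..<1}) (at_right (0::real))"
      by (rule eventually_at_right_real) simp
    hence "eventually (\<lambda>\<delta>. 0 \<le> (\<Sum>j<n. (lam j - (b + q \<delta>)) * (g j)\<^sup>2)) (at_right 0)"
      by (rule eventually_mono) (use True pos_case in auto)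
    ultimately show ?thesis using True
      by (auto intro: tendsto_lowerbound)
  qed
  thus ?thesis by (simp add: q_def S_def \<sigma>_def)
qed
text \<open>The vector \<open>Bx\<close> is the orthogonal sum of \<open>k x\<close> and the residual \<open>Bx - k x\<close>, hence longer than the
residual; a ball around it whose radius is at most the length of the residual misses the origin.\<close>

lemma ball_avoids_zero:
  fixes lam f g :: "nat \<Rightarrow> real"
  assumes "0 \<le> \<gamma>" "\<gamma> < 1" "0 < k" and f: "0 < (\<Sum>j<n. (f j)\<^sup>2)"
    and mean: "(\<Sum>j<n. (lam j - k) * (f j)\<^sup>2) = 0"
    and ball: "(\<Sum>j<n. (g j - lam j * f j)\<^sup>2) \<le> \<gamma>\<^sup>2 * (\<Sum>j<n. ((lam j - k) * f j)\<^sup>2)"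
  shows "0 < (\<Sum>j<n. (g j)\<^sup>2)"
proof (rule ccontr)
  assume "\<not> ?thesis"
  hence "(\<Sum>j<n. (g j)\<^sup>2) = 0" using sum_nonneg[of "{..<n}" "\<lambda>j. (g j)\<^sup>2"] by simp
  hence g: "g j = 0" if "j < n" for j using that by (simp add: sum_nonneg_eq_0_iff)
  define N where "N = (\<Sum>j<n. (f j)\<^sup>2)"
  define R where "R = (\<Sum>j<n. ((lam j - k) * f j)\<^sup>2)"
  have "(\<Sum>j<n. (g j - lam j * f j)\<^sup>2) =
      (\<Sum>j<n. ((lam j - k) * f j)\<^sup>2 + 2 * k * ((lam j - k) * (f j)\<^sup>2) + k\<^sup>2 * (f j)\<^sup>2)"
    by (intro sum.cong refl) (simp add: g power2_eq_square algebra_simps)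
  also have "\<dots> = R + k\<^sup>2 * N"
    by (simp add: sum.distrib R_def N_def mean flip: sum_distrib_left)
  finally have "R + k\<^sup>2 * N \<le> \<gamma>\<^sup>2 * R" using ball by (simp add: R_def)
  moreover have "\<gamma>\<^sup>2 * R \<le> 1 * R"
    using assms(1,2) by (intro mult_right_mono) (auto simp: R_def power_le_one sum_nonneg)
  moreover have "k\<^sup>2 * N > 0" using f \<open>0 < k\<close> by (simp add: N_def)
  ultimately show False by linarith
qed

text \<open>Translates a lower bound on the new Rayleigh quotient \<open>R\<close> into the estimate for the fractions, which
decrease in \<open>R\<close>.\<close>

lemma ratio_bound:
  fixes a b k R \<sigma> :: real
  assumes "b < k" "k \<le> a" "\<sigma>\<^sup>2 \<le> 1" and R: "b + (a-b)*(k-b)/((k-b) + \<sigma>\<^sup>2*(a-k)) \<le> R"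
  shows "k \<le> R" "(a - R) / (R - b) \<le> \<sigma>\<^sup>2 * ((a - k) / (k - b))"
proof -
  define D where "D = (k-b) + \<sigma>\<^sup>2*(a-k)"
  have D: "D > 0" "D \<le> a - b"
    using assms(1,2) mult_right_mono[OF assms(3), of "a-k"] by (auto simp: D_def intro!: add_pos_nonneg)
  define q where "q = (a-b)*(k-b)/D"
  have qD: "q * D = (a-b)*(k-b)" using D by (simp add: q_def)
  have "(k-b) * D \<le> (k-b) * (a-b)" using D assms by (intro mult_left_mono) auto
  hence kq: "k - b \<le> q" using D by (simp add: q_def pos_le_divide_eq mult.commute)
  have Rq: "b + q \<le> R" using R by (simp add: q_def D_def)
  show "k \<le> R" using kq Rq by linarith
  have pos: "0 < R - b" "0 < k - b" using Rq kq assms by linarith+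
  have "(a - R) * (k - b) \<le> (a - b - q) * (k - b)" using Rq pos by (intro mult_right_mono) auto
  also have "\<dots> = \<sigma>\<^sup>2 * (a - k) * q" using qD by (simp add: D_def algebra_simps)
  also have "\<dots> \<le> \<sigma>\<^sup>2 * (a - k) * (R - b)" using Rq assms by (intro mult_left_mono) auto
  finally show "(a - R) / (R - b) \<le> \<sigma>\<^sup>2 * ((a - k) / (k - b))"
    using pos by (simp add: pos_divide_le_eq pos_le_divide_eq)
qed

section \<open>Adjoints, congruence and quadratic forms\<close>

lemma adjoint_carrier [simp]: "M \<in> carrier_mat n m \<Longrightarrow> mat_adjoint M \<in> carrier_mat m n"
  by (auto simp: mat_adjoint_def)

lemma adjoint_dim [simp]: "dim_row (mat_adjoint M) = dim_col M" "dim_col (mat_adjoint M) = dim_row M"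
  by (auto simp: mat_adjoint_def)

lemma adjoint_index [simp]:
  "i < dim_col M \<Longrightarrow> j < dim_row M \<Longrightarrow> mat_adjoint M $$ (i,j) = conjugate (M $$ (j,i))"
  by (auto simp: mat_adjoint_def mat_of_rows_index)

lemma adjoint_adjoint [simp]: "mat_adjoint (mat_adjoint M) = M"
  by (rule eq_matI) auto

lemma conjugate_adjoint_mult:
  assumes "M \<in> carrier_mat n m" "w \<in> carrier_vec n"
  shows "conjugate (mat_adjoint M *\<^sub>v w) = M\<^sup>T *\<^sub>v conjugate w"
  using assms
  by (intro eq_vecI) (auto simp: scalar_prod_def sum_conjugate conjugate_dist_mul intro!: sum.cong)

lemma cscalar_adjoint:
  assumes "M \<in> carrier_mat n m" "z \<in> carrier_vec m" "w \<in> carrier_vec n"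
  shows "(M *\<^sub>v z) \<bullet>c w = z \<bullet>c (mat_adjoint M *\<^sub>v w)"
proof -
  have "(M *\<^sub>v z) \<bullet>c w = conjugate w \<bullet> (M *\<^sub>v z)"
    using assms by (intro comm_scalar_prod[of _ n]) auto
  also have "\<dots> = (M\<^sup>T *\<^sub>v conjugate w) \<bullet> z"
    using assms by (intro transpose_vec_mult_scalar[symmetric, of _ n m]) auto
  also have "\<dots> = z \<bullet>c (mat_adjoint M *\<^sub>v w)" unfolding conjugate_adjoint_mult[OF assms(1,3)]
    using assms by (intro comm_scalar_prod[of _ m]) auto
  finally show ?thesis .
qed

lemma hermitian_carrier: "hermitian_mat n M \<Longrightarrow> M \<in> carrier_mat n n"
  and pos_def_hermitian: "pos_def_mat n M \<Longrightarrow> hermitian_mat n M"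
  by (auto simp: hermitian_mat_def pos_def_mat_def)

lemma hermitian_cscalar:
  assumes "hermitian_mat n M" "z \<in> carrier_vec n" "w \<in> carrier_vec n"
  shows "(M *\<^sub>v z) \<bullet>c w = z \<bullet>c (M *\<^sub>v w)"
  using cscalar_adjoint[of M n n z w] assms by (simp add: hermitian_mat_def)

lemma adjoint_mult:
  assumes "M \<in> carrier_mat n m" "N \<in> carrier_mat m k"
  shows "mat_adjoint (M * N) = mat_adjoint N * mat_adjoint (M :: 'a::conjugatable_field mat)"
  using assms
  by (intro eq_matI) (auto simp: scalar_prod_def sum_conjugate conjugate_dist_mul mult.commute intro!: sum.cong)

lemma hermitian_congruence:
  assumes "hermitian_mat n M" and Q: "Q \<in> carrier_mat n m"
  shows "hermitian_mat m (mat_adjoint Q * M * Q)"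
proof -
  note M = hermitian_carrier[OF assms(1)] and Q' = adjoint_carrier[OF Q]
  have QM: "mat_adjoint Q * M \<in> carrier_mat m n" by (rule mult_carrier_mat[OF Q' M])
  have "mat_adjoint (mat_adjoint Q * M * Q) = mat_adjoint Q * (mat_adjoint M * mat_adjoint (mat_adjoint Q))"
    unfolding adjoint_mult[OF QM Q] adjoint_mult[OF Q' M] ..
  also have "\<dots> = mat_adjoint Q * M * Q"
    using assms(1) assoc_mult_mat[OF Q' M Q] by (simp add: hermitian_mat_def)
  finally show ?thesis using mult_carrier_mat[OF QM Q] by (simp add: hermitian_mat_def)
qed

lemma congruence_mult_vec:
  assumes M: "M \<in> carrier_mat n n" and Q: "Q \<in> carrier_mat n m" and y: "y \<in> carrier_vec m"
  shows "(mat_adjoint Q * M * Q) *\<^sub>v y = mat_adjoint Q *\<^sub>v (M *\<^sub>v (Q *\<^sub>v y))"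
  using assoc_mult_mat_vec[OF mult_carrier_mat[OF adjoint_carrier[OF Q] M] Q y]
    assoc_mult_mat_vec[OF adjoint_carrier[OF Q] M mult_mat_vec_carrier[OF Q y]] by simp

lemma congruence_cscalar:
  assumes M: "M \<in> carrier_mat n n" and Q: "Q \<in> carrier_mat n m" and y: "y \<in> carrier_vec m"
    and z: "z \<in> carrier_vec m"
  shows "(Q *\<^sub>v z) \<bullet>c (M *\<^sub>v (Q *\<^sub>v y)) = z \<bullet>c ((mat_adjoint Q * M * Q) *\<^sub>v y)"
  using cscalar_adjoint[OF Q z mult_mat_vec_carrier[OF M mult_mat_vec_carrier[OF Q y]]]
  by (simp only: congruence_mult_vec[OF M Q y])

lemma quad_form_congruence:
  assumes "M \<in> carrier_mat n n" "Q \<in> carrier_mat n m" "z \<in> carrier_vec m"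
  shows "quad_form M (Q *\<^sub>v z) = quad_form (mat_adjoint Q * M * Q) z"
  using congruence_cscalar[OF assms(1,2,3,3)] by (simp add: quad_form_def)

lemma pos_def_congruence:
  assumes M: "pos_def_mat n M" and Q: "Q \<in> carrier_mat n m"
    and inj: "\<And>z. z \<in> carrier_vec m \<Longrightarrow> Q *\<^sub>v z = 0\<^sub>v n \<Longrightarrow> z = 0\<^sub>v m"
  shows "pos_def_mat m (mat_adjoint Q * M * Q)"
proof -
  have "0 < quad_form (mat_adjoint Q * M * Q) z" if z: "z \<in> carrier_vec m" "z \<noteq> 0\<^sub>v m" for z
  proof -
    have "Q *\<^sub>v z \<noteq> 0\<^sub>v n" "Q *\<^sub>v z \<in> carrier_vec n" using inj z Q by auto
    hence "0 < quad_form M (Q *\<^sub>v z)" using M unfolding pos_def_mat_def by blast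
    thus ?thesis using quad_form_congruence[OF hermitian_carrier[OF pos_def_hermitian[OF M]] Q z(1)] by simp
  qed
  thus ?thesis using hermitian_congruence[OF pos_def_hermitian[OF M] Q] unfolding pos_def_mat_def by blast
qed

lemma mat_diag_mult_vec_index:
  assumes "z \<in> carrier_vec n" "i < n"
  shows "(mat_diag n f *\<^sub>v z) $ i = f i * (z $ i :: 'a::semiring_1)"
  using assms
  by (simp add: scalar_prod_def mat_diag_def if_distrib[of "\<lambda>x. x * _"] cong: if_cong)

lemma cscalar_sum:
  assumes "z \<in> carrier_vec n" "w \<in> carrier_vec n"
  shows "z \<bullet>c w = (\<Sum>i<n. z $ i * conjugate (w $ i))"
  using assms unfolding scalar_prod_def by (simp add: lessThan_atLeast0)

lemma quad_form_mat_diag: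
  fixes z :: "'a::real_or_complex vec"
  assumes "z \<in> carrier_vec n"
  shows "quad_form (mat_diag n (\<lambda>i. of_real (l i))) z = (\<Sum>i<n. l i * (norm (z $ i))\<^sup>2)"
proof -
  let ?D = "mat_diag n (\<lambda>i. of_real (l i) :: 'a)"
  have "?D *\<^sub>v z \<in> carrier_vec n" by (rule mult_mat_vec_carrier[OF mat_diag_dim assms])
  hence "z \<bullet>c (?D *\<^sub>v z) = (\<Sum>i<n. z $ i * conjugate ((?D *\<^sub>v z) $ i))"
    by (rule cscalar_sum[OF assms])
  also have "\<dots> = (\<Sum>i<n. z $ i * conjugate (of_real (l i) * z $ i))"
    using mat_diag_mult_vec_index[OF assms] by (intro sum.cong) auto
  also have "\<dots> = (\<Sum>i<n. of_real (l i * (norm (z $ i))\<^sup>2))"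
    by (intro sum.cong) (auto simp: conjugate_dist_mul conjugate_of_real mult_conjugate[symmetric] simp del: of_real_power)
  also have "\<dots> = of_real (\<Sum>i<n. l i * (norm (z $ i))\<^sup>2)" by simp
  finally show ?thesis unfolding quad_form_def by (simp only: inner_one_of_real)
qed

lemma quad_form_one:
  fixes z :: "'a::real_or_complex vec"
  assumes "z \<in> carrier_vec n"
  shows "quad_form (1\<^sub>m n) z = (\<Sum>i<n. (norm (z $ i))\<^sup>2)"
proof -
  have "1\<^sub>m n = mat_diag n (\<lambda>i. of_real 1 :: 'a)" by (auto simp: mat_diag_def)
  thus ?thesis using quad_form_mat_diag[OF assms, of "\<lambda>_. 1"] by simp
qed

lemma cscalar_conjugate_commute:
  assumes z: "z \<in> carrier_vec n" and w: "w \<in> carrier_vec n"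
  shows "conjugate (z \<bullet>c w) = w \<bullet>c (z :: 'a::conjugatable_field vec)"
proof -
  have "conjugate (z \<bullet>c w) = conjugate (conjugate w \<bullet> z)"
    unfolding conjugate_vec_sprod_comm[OF z w] ..
  thus ?thesis by (simp only: conjugate_conjugate_sprod[OF w z])
qed

lemma quad_form_of_real:
  fixes z :: "'a::real_or_complex vec"
  assumes "hermitian_mat n M" "z \<in> carrier_vec n"
  shows "z \<bullet>c (M *\<^sub>v z) = of_real (quad_form M z)"
proof -
  have "M *\<^sub>v z \<in> carrier_vec n" using hermitian_carrier[OF assms(1)] assms(2) by auto
  hence "conjugate (z \<bullet>c (M *\<^sub>v z)) = (M *\<^sub>v z) \<bullet>c z" using cscalar_conjugate_commute assms(2) by blast
  also have "\<dots> = z \<bullet>c (M *\<^sub>v z)" by (rule hermitian_cscalar[OF assms assms(2)])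
  finally show ?thesis unfolding quad_form_def by (rule conjugate_fixed)
qed

lemma quad_form_smult:
  fixes z :: "'a::real_or_complex vec"
  assumes "M \<in> carrier_mat n n" "z \<in> carrier_vec n"
  shows "quad_form M (of_real c \<cdot>\<^sub>v z) = c\<^sup>2 * quad_form M z"
proof -
  have "M *\<^sub>v (of_real c \<cdot>\<^sub>v z) = of_real c \<cdot>\<^sub>v (M *\<^sub>v z)" using assms by (simp add: mult_mat_vec)
  hence "(of_real c \<cdot>\<^sub>v z) \<bullet>c (M *\<^sub>v (of_real c \<cdot>\<^sub>v z)) = of_real c * of_real c * (z \<bullet>c (M *\<^sub>v z))"
    using assms by (simp add: conjugate_smult_vec conjugate_of_real)
  also have "\<dots> = c\<^sup>2 *\<^sub>R (z \<bullet>c (M *\<^sub>v z))" by (simp add: power2_eq_square scaleR_conv_of_real)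
  finally show ?thesis by (simp add: quad_form_def)
qed

section \<open>Simultaneous diagonalization of a definite pencil\<close>

text \<open>A basis of the orthogonal complement of \<open>w\<close>: drop from the standard basis one vector \<open>e\<^sub>k\<close> with
\<open>v\<^sub>k \<noteq> 0\<close>, and project the others along \<open>v\<close>. For \<open>w = A v\<close> this is the \<open>A\<close>-orthogonal complement of \<open>v\<close>.\<close>

lemma orthogonal_complement_frame:
  fixes v w :: "'a::conjugatable_field vec"
  assumes v: "v \<in> carrier_vec (Suc n)" and w: "w \<in> carrier_vec (Suc n)" and wv: "w \<bullet>c v = 1"
  obtains Q where "Q \<in> carrier_mat (Suc n) n" "mat_adjoint Q *\<^sub>v w = 0\<^sub>v n"
    "\<And>z. z \<in> carrier_vec n \<Longrightarrow> Q *\<^sub>v z = 0\<^sub>v (Suc n) \<Longrightarrow> z = 0\<^sub>v n"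
proof -
  have wv_sum: "(\<Sum>i<Suc n. w $ i * conjugate (v $ i)) = 1"
    using wv v w unfolding scalar_prod_def by (simp add: lessThan_atLeast0 del: sum.op_ivl_Suc)
  have "\<exists>k<Suc n. v $ k \<noteq> 0"
  proof (rule ccontr)
    assume "\<not> (\<exists>k<Suc n. v $ k \<noteq> 0)"
    hence "(\<Sum>i<Suc n. w $ i * conjugate (v $ i)) = 0" by (intro sum.neutral) auto
    thus False using wv_sum by simp
  qed
  then obtain k where k: "k < Suc n" "v $ k \<noteq> 0" by blast
  define s where "s j = (if j < k then j else Suc j)" for j
  have s: "s j < Suc n" "s j \<noteq> k" if "j < n" for j using that k by (auto simp: s_def)
  have s_inj: "s i = s j \<longleftrightarrow> i = j" for i j by (auto simp: s_def)
  define Q where "Q = mat (Suc n) n (\<lambda>(i,j). (if i = s j then 1 else 0) - conjugate (w $ s j) * v $ i)"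
  have Q: "Q \<in> carrier_mat (Suc n) n" by (simp add: Q_def)
  show thesis
  proof (rule that[OF Q])
    show "mat_adjoint Q *\<^sub>v w = 0\<^sub>v n"
    proof (rule eq_vecI)
      fix j assume "j < dim_vec (0\<^sub>v n)"
      hence j: "j < n" by simp
      have "(mat_adjoint Q *\<^sub>v w) $ j = (\<Sum>i<Suc n. mat_adjoint Q $$ (j,i) * w $ i)"
        using j w Q by (simp add: scalar_prod_def lessThan_atLeast0 del: sum.op_ivl_Suc adjoint_index)
      also have "\<dots> = (\<Sum>i<Suc n. (if i = s j then w $ i else 0) - w $ s j * (w $ i * conjugate (v $ i)))"
      proof (rule sum.cong[OF refl])
        fix i assume "i \<in> {..<Suc n}"
        hence i: "i < Suc n" by simp
        have eq: "mat_adjoint Q $$ (j,i) = (if i = s j then 1 else 0) - w $ s j * conjugate (v $ i)"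
          using i j conjugate_dist_add[of "(if i = s j then 1 else 0) :: 'a"]
          by (auto simp: Q_def conjugate_dist_mul conjugate_neg diff_conv_add_uminus conjugate_dist_add
              simp del: add_uminus_conv_diff)
        show "mat_adjoint Q $$ (j,i) * w $ i = (if i = s j then w $ i else 0) - w $ s j * (w $ i * conjugate (v $ i))"
          unfolding eq by (cases "i = s j") (simp_all add: algebra_simps)
      qed
      also have "\<dots> = w $ s j - w $ s j * (\<Sum>i<Suc n. w $ i * conjugate (v $ i))"
        using s(1)[OF j] by (simp add: sum_subtractf sum_distrib_left del: sum.lessThan_Suc)
      finally show "(mat_adjoint Q *\<^sub>v w) $ j = 0\<^sub>v n $ j" using wv_sum j by simp
    qed (use Q in auto)
  next
    fix z assume z: "z \<in> carrier_vec n" and Qz: "Q *\<^sub>v z = 0\<^sub>v (Suc n)"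
    define T where "T = (\<Sum>j<n. conjugate (w $ s j) * z $ j)"
    have Qi: "(\<Sum>j<n. if i = s j then z $ j else 0) - v $ i * T = 0" if i: "i < Suc n" for i
    proof -
      have "0 = (Q *\<^sub>v z) $ i" using Qz i by simp
      also have "\<dots> = (\<Sum>j<n. Q $$ (i,j) * z $ j)"
        using i z Q by (simp add: scalar_prod_def lessThan_atLeast0)
      also have "\<dots> = (\<Sum>j<n. (if i = s j then z $ j else 0) - v $ i * (conjugate (w $ s j) * z $ j))"
        using i by (intro sum.cong) (auto simp: Q_def algebra_simps)
      finally show ?thesis by (simp add: T_def sum_subtractf sum_distrib_left)
    qed
    have "(\<Sum>j<n. if k = s j then z $ j else 0) = 0" by (intro sum.neutral) (use s in auto)
    hence T0: "T = 0" using Qi[OF k(1)] k(2) by simp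
    show "z = 0\<^sub>v n"
    proof (rule eq_vecI)
      fix j assume "j < dim_vec (0\<^sub>v n)"
      hence j: "j < n" by simp
      have "(\<Sum>l<n. if s j = s l then z $ l else 0) = z $ j" using j by (simp add: s_inj)
      thus "z $ j = 0\<^sub>v n $ j" using Qi[OF s(1)[OF j]] T0 j by simp
    qed (use z in auto)
  qed
qed

lemma congruence_index:
  assumes M: "M \<in> carrier_mat n n" and P: "P \<in> carrier_mat n m" and ij: "i < m" "j < m"
  shows "(mat_adjoint P * M * P) $$ (i,j) = (M *\<^sub>v col P j) \<bullet>c col (P :: 'a::conjugatable_field mat) i"
proof -
  note P' = adjoint_carrier[OF P]
  have c: "col P i \<in> carrier_vec n" "col P j \<in> carrier_vec n" using P by auto
  have r: "row (mat_adjoint P) i = conjugate (col P i)"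
    using P ij by (intro eq_vecI) auto
  have "(mat_adjoint P * M * P) $$ (i,j) = (mat_adjoint P * (M * P)) $$ (i,j)"
    unfolding assoc_mult_mat[OF P' M P] ..
  also have "\<dots> = row (mat_adjoint P) i \<bullet> col (M * P) j"
    using P M ij by simp
  also have "\<dots> = conjugate (col P i) \<bullet> (M *\<^sub>v col P j)"
    unfolding r col_mult2[OF M P ij(2)] ..
  also have "\<dots> = (M *\<^sub>v col P j) \<bullet>c col P i"
    by (rule conjugate_vec_sprod_comm[symmetric, OF mult_mat_vec_carrier[OF M c(2)] c(1)])
  finally show ?thesis .
qed

lemma bordered_carrier:
  "R \<in> carrier_mat m n \<Longrightarrow> mat_of_cols m (v # cols R) \<in> carrier_mat m (Suc n)"
  by auto

text \<open>The induction step of the diagonalization, stated for a matrix \<open>X\<close> that will be \<open>A\<close> (with \<open>\<mu> = 1\<close>) or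
\<open>B\<close>: since \<open>v\<close> is an eigenvector and the columns of \<open>R\<close> are \<open>A\<close>-orthogonal to \<open>v\<close>, they are orthogonal
to \<open>v\<close> with respect to \<open>X\<close> as well, and the congruent matrix is block diagonal.\<close>

lemma bordered_congruence:
  fixes A X :: "'a::real_or_complex mat"
  assumes A: "hermitian_mat (Suc n) A" and X: "hermitian_mat (Suc n) X"
    and v: "v \<in> carrier_vec (Suc n)" and norm: "(A *\<^sub>v v) \<bullet>c v = 1"
    and eig: "X *\<^sub>v v = of_real \<mu> \<cdot>\<^sub>v (A *\<^sub>v v)"
    and R: "R \<in> carrier_mat (Suc n) n" and orth: "mat_adjoint R *\<^sub>v (A *\<^sub>v v) = 0\<^sub>v n"
    and diag: "mat_adjoint R * X * R = mat_diag n (\<lambda>i. of_real (l i))"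
  defines "P \<equiv> mat_of_cols (Suc n) (v # cols R)"
  shows "mat_adjoint P * X * P = mat_diag (Suc n) (\<lambda>i. of_real (case_nat \<mu> l i))"
proof -
  have P: "P \<in> carrier_mat (Suc n) (Suc n)" using R by (auto simp: P_def)
  have colR: "col R j \<in> carrier_vec (Suc n)" for j using R col_dim[of R j] by simp
  have col0: "col P 0 = v" using v by (simp add: P_def)
  have colS: "col P (Suc j) = col R j" if "j < n" for j
    using that R colR[of j] by (simp add: P_def)
  note Xc = hermitian_carrier[OF X] and Ac = hermitian_carrier[OF A]
  have w: "A *\<^sub>v v \<in> carrier_vec (Suc n)" by (rule mult_mat_vec_carrier[OF Ac v])
  have R0: "(A *\<^sub>v v) \<bullet>c col R j = 0" if j: "j < n" for j
  proof -
    have "row (mat_adjoint R) j = conjugate (col R j)" using R j by (intro eq_vecI) auto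
    hence "conjugate (col R j) \<bullet> (A *\<^sub>v v) = (mat_adjoint R *\<^sub>v (A *\<^sub>v v)) $ j" using R j by simp
    also have "\<dots> = 0" using orth j by simp
    finally show ?thesis using conjugate_vec_sprod_comm[OF w colR] by simp
  qed
  have R1: "(X *\<^sub>v v) \<bullet>c col R j = 0" if j: "j < n" for j
    unfolding eig using R0[OF j] w colR[of j] by simp
  have R2: "(X *\<^sub>v col R j) \<bullet>c v = 0" if j: "j < n" for j
  proof -
    have Xv: "X *\<^sub>v v \<in> carrier_vec (Suc n)" by (rule mult_mat_vec_carrier[OF Xc v])
    have "(X *\<^sub>v col R j) \<bullet>c v = col R j \<bullet>c (X *\<^sub>v v)" by (rule hermitian_cscalar[OF X colR v])
    also have "\<dots> = conjugate ((X *\<^sub>v v) \<bullet>c col R j)"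
      by (rule cscalar_conjugate_commute[symmetric, OF Xv colR])
    finally show ?thesis using R1[OF j] by simp
  qed
  show ?thesis
  proof (rule eq_matI)
    fix i j assume "i < dim_row (mat_diag (Suc n) (\<lambda>i. of_real (case_nat \<mu> l i) :: 'a))"
      "j < dim_col (mat_diag (Suc n) (\<lambda>i. of_real (case_nat \<mu> l i) :: 'a))"
    hence ij: "i < Suc n" "j < Suc n" by (auto simp: mat_diag_def)
    have "(X *\<^sub>v col P j) \<bullet>c col P i = mat_diag (Suc n) (\<lambda>i. of_real (case_nat \<mu> l i)) $$ (i,j)"
    proof (cases i)
      case i0: 0
      show ?thesis
      proof (cases j)
        case 0
        have "(X *\<^sub>v v) \<bullet>c v = of_real \<mu>" unfolding eig using norm w v by simp
        thus ?thesis using i0 0 col0 by (simp add: mat_diag_def)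
      next
        case (Suc j')
        thus ?thesis using i0 col0 colS[of j'] R2[of j'] ij by (simp add: mat_diag_def)
      qed
    next
      case iS: (Suc i')
      show ?thesis
      proof (cases j)
        case 0
        thus ?thesis using iS col0 colS[of i'] R1[of i'] ij by (simp add: mat_diag_def)
      next
        case (Suc j')
        have "(X *\<^sub>v col R j') \<bullet>c col R i' = mat_diag n (\<lambda>i. of_real (l i)) $$ (i',j')"
          using congruence_index[OF Xc R, of i' j'] diag ij iS Suc by simp
        thus ?thesis using iS Suc colS[of i'] colS[of j'] ij by (simp add: mat_diag_def)
      qed
    qed
    thus "(mat_adjoint P * X * P) $$ (i,j) = mat_diag (Suc n) (\<lambda>i. of_real (case_nat \<mu> l i)) $$ (i,j)"
      unfolding congruence_index[OF Xc P ij] .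
  qed (use P in \<open>auto simp: mat_diag_def\<close>)
qed

lemma congruence_mult:
  fixes X :: "'a::conjugatable_field mat"
  assumes X: "X \<in> carrier_mat n n" and Q: "Q \<in> carrier_mat n m" and P: "P \<in> carrier_mat m k"
  shows "mat_adjoint (Q * P) * X * (Q * P) = mat_adjoint P * (mat_adjoint Q * X * Q) * P"
proof -
  note Q' = adjoint_carrier[OF Q] and P' = adjoint_carrier[OF P]
  have "mat_adjoint (Q * P) * X * (Q * P) = (mat_adjoint P * mat_adjoint Q) * (X * (Q * P))"
    unfolding adjoint_mult[OF Q P]
    by (rule assoc_mult_mat[OF mult_carrier_mat[OF P' Q'] X mult_carrier_mat[OF Q P]])
  also have "\<dots> = mat_adjoint P * (mat_adjoint Q * (X * (Q * P)))"
    by (rule assoc_mult_mat[OF P' Q' mult_carrier_mat[OF X mult_carrier_mat[OF Q P]]])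
  also have "X * (Q * P) = X * Q * P" by (rule assoc_mult_mat[symmetric, OF X Q P])
  also have "mat_adjoint Q * (X * Q * P) = mat_adjoint Q * (X * Q) * P"
    by (rule assoc_mult_mat[symmetric, OF Q' mult_carrier_mat[OF X Q] P])
  also have "mat_adjoint Q * (X * Q) = mat_adjoint Q * X * Q"
    by (rule assoc_mult_mat[symmetric, OF Q' X Q])
  also have "mat_adjoint P * (mat_adjoint Q * X * Q * P) = mat_adjoint P * (mat_adjoint Q * X * Q) * P"
    by (rule assoc_mult_mat[symmetric, OF P' mult_carrier_mat[OF mult_carrier_mat[OF Q' X] Q] P])
  finally show ?thesis .
qed

lemma normalized_vector:
  fixes A :: "'a::real_or_complex mat"
  assumes A: "pos_def_mat n A" and u: "u \<in> carrier_vec n" "u \<noteq> 0\<^sub>v n"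
  obtains c where "(A *\<^sub>v (of_real c \<cdot>\<^sub>v u)) \<bullet>c (of_real c \<cdot>\<^sub>v u) = 1"
proof -
  define c where "c = 1 / sqrt (quad_form A u)"
  have pos: "quad_form A u > 0" using A u by (auto simp: pos_def_mat_def)
  note Ah = pos_def_hermitian[OF A]
  have cu: "of_real c \<cdot>\<^sub>v u \<in> carrier_vec n" using u by simp
  have c2: "c\<^sup>2 * quad_form A u = 1" using pos by (simp add: c_def power_divide)
  have "(A *\<^sub>v (of_real c \<cdot>\<^sub>v u)) \<bullet>c (of_real c \<cdot>\<^sub>v u) = of_real (quad_form A (of_real c \<cdot>\<^sub>v u))"
    using hermitian_cscalar[OF Ah cu cu] quad_form_of_real[OF Ah cu] by simp
  also have "quad_form A (of_real c \<cdot>\<^sub>v u) = 1"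
    using c2 quad_form_smult[OF hermitian_carrier[OF Ah] u(1)] by simp
  finally show thesis using that by simp
qed

text \<open>Restricting the form to the \<open>A\<close>-orthogonal complement of \<open>u\<close> keeps it definite and lowers the
dimension by one. The scaled vector \<open>c u\<close> is the unit vector that \<open>bordered_congruence\<close> needs.\<close>

lemma deflation:
  fixes A :: "'a::real_or_complex mat"
  assumes A: "pos_def_mat (Suc n) A" and u: "u \<in> carrier_vec (Suc n)" "u \<noteq> 0\<^sub>v (Suc n)"
  obtains c Q where "(A *\<^sub>v (of_real c \<cdot>\<^sub>v u)) \<bullet>c (of_real c \<cdot>\<^sub>v u) = 1" "Q \<in> carrier_mat (Suc n) n"
    "mat_adjoint Q *\<^sub>v (A *\<^sub>v (of_real c \<cdot>\<^sub>v u)) = 0\<^sub>v n" "pos_def_mat n (mat_adjoint Q * A * Q)"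
proof -
  obtain c where c: "(A *\<^sub>v (of_real c \<cdot>\<^sub>v u)) \<bullet>c (of_real c \<cdot>\<^sub>v u) = 1"
    using normalized_vector[OF A u] by blast
  note Ac = hermitian_carrier[OF pos_def_hermitian[OF A]]
  have v: "of_real c \<cdot>\<^sub>v u \<in> carrier_vec (Suc n)" using u by simp
  obtain Q where Q: "Q \<in> carrier_mat (Suc n) n" "mat_adjoint Q *\<^sub>v (A *\<^sub>v (of_real c \<cdot>\<^sub>v u)) = 0\<^sub>v n"
    "\<And>z. z \<in> carrier_vec n \<Longrightarrow> Q *\<^sub>v z = 0\<^sub>v (Suc n) \<Longrightarrow> z = 0\<^sub>v n"
    using orthogonal_complement_frame[OF v mult_mat_vec_carrier[OF Ac v] c] by blast
  show thesis using that[OF c Q(1,2)] pos_def_congruence[OF A Q(1,3)] by blast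
qed

lemma adjoint_mult_orth:
  fixes w :: "'a::conjugatable_field vec"
  assumes Q: "Q \<in> carrier_mat n m" and P: "P \<in> carrier_mat m k" and w: "w \<in> carrier_vec n"
    and "mat_adjoint Q *\<^sub>v w = 0\<^sub>v m"
  shows "mat_adjoint (Q * P) *\<^sub>v w = 0\<^sub>v k"
proof -
  have "mat_adjoint (Q * P) *\<^sub>v w = mat_adjoint P *\<^sub>v (mat_adjoint Q *\<^sub>v w)"
    unfolding adjoint_mult[OF Q P]
    by (rule assoc_mult_mat_vec[OF adjoint_carrier[OF P] adjoint_carrier[OF Q] w])
  also have "\<dots> = mat_adjoint P *\<^sub>v 0\<^sub>v m" using assms(4) by simp
  also have "\<dots> = 0\<^sub>v k" using P by (intro eq_vecI) (auto simp: scalar_prod_def)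
  finally show ?thesis .
qed

lemma one_mat_diag: "1\<^sub>m n = mat_diag n (\<lambda>i. of_real 1 :: 'a::real_or_complex)"
  by (auto simp: mat_diag_def)

text \<open>Every vector is an eigenvector of the pencil of \<open>A\<close> with itself, so deflation can start anywhere.
The purpose is to reduce the eigenvalue problem of a pencil to that of a single Hermitian matrix.\<close>

lemma pos_def_congruent_one:
  fixes A :: "'a::real_or_complex mat"
  assumes "pos_def_mat n A"
  shows "\<exists>R \<in> carrier_mat n n. mat_adjoint R * A * R = 1\<^sub>m n"
  using assms
proof (induction n arbitrary: A)
  case 0
  thus ?case by (intro bexI[of _ "1\<^sub>m 0"]) (auto dest!: pos_def_hermitian hermitian_carrier)
next
  case (Suc n)
  note Ah = pos_def_hermitian[OF Suc.prems] and Ac = hermitian_carrier[OF pos_def_hermitian[OF Suc.prems]]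
  define u :: "'a vec" where "u = unit_vec (Suc n) 0"
  have u: "u \<in> carrier_vec (Suc n)" "u \<noteq> 0\<^sub>v (Suc n)" by (auto simp: u_def dest: unit_vec_nonzero)
  obtain c Q where cQ: "(A *\<^sub>v (of_real c \<cdot>\<^sub>v u)) \<bullet>c (of_real c \<cdot>\<^sub>v u) = 1" "Q \<in> carrier_mat (Suc n) n"
    "mat_adjoint Q *\<^sub>v (A *\<^sub>v (of_real c \<cdot>\<^sub>v u)) = 0\<^sub>v n" "pos_def_mat n (mat_adjoint Q * A * Q)"
    using deflation[OF Suc.prems u] by blast
  define v where "v = of_real c \<cdot>\<^sub>v u"
  have v: "v \<in> carrier_vec (Suc n)" using u by (simp add: v_def)
  obtain P where P: "P \<in> carrier_mat n n" "mat_adjoint P * (mat_adjoint Q * A * Q) * P = 1\<^sub>m n"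
    using Suc.IH[OF cQ(4)] by blast
  have QP: "Q * P \<in> carrier_mat (Suc n) n" by (rule mult_carrier_mat[OF cQ(2) P(1)])
  have d: "mat_adjoint (Q * P) * A * (Q * P) = mat_diag n (\<lambda>i. of_real 1)"
    unfolding congruence_mult[OF Ac cQ(2) P(1)] P(2) one_mat_diag ..
  have e: "A *\<^sub>v v = of_real 1 \<cdot>\<^sub>v (A *\<^sub>v v)" by simp
  have "mat_adjoint (mat_of_cols (Suc n) (v # cols (Q * P))) * A * (mat_of_cols (Suc n) (v # cols (Q * P)))
      = mat_diag (Suc n) (\<lambda>i. of_real (case_nat 1 (\<lambda>_. 1) i))"
    by (rule bordered_congruence[OF Ah Ah v cQ(1)[folded v_def] e QP _ d])
      (rule adjoint_mult_orth[OF cQ(2) P(1) mult_mat_vec_carrier[OF Ac v] cQ(3)[folded v_def]])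
  also have "\<dots> = 1\<^sub>m (Suc n)" by (auto simp: mat_diag_def split: nat.splits)
  finally show ?case using bordered_carrier[OF QP] by blast
qed
text \<open>Over \<open>\<complex>\<close> there is an eigenvalue, and it is real because the matrix is Hermitian. Being real, it comes
from the scalar field itself, and the vanishing of the characteristic determinant can be pulled back
along the embedding.\<close>

lemma hermitian_eigenpair:
  fixes C :: "'a::real_or_complex mat"
  assumes C: "hermitian_mat n C" and n: "n > 0"
  obtains r v where "v \<in> carrier_vec n" "v \<noteq> 0\<^sub>v n" "C *\<^sub>v v = of_real r \<cdot>\<^sub>v v"
proof -
  note Cc = hermitian_carrier[OF C]
  obtain h :: "'a \<Rightarrow> complex" where h: "h 1 = 1" "\<And>x y. h (x + y) = h x + h y"
    "\<And>x y. h (x * y) = h x * h y" "\<And>x. h (conjugate x) = cnj (h x)"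
    "\<And>r. h (of_real r) = complex_of_real r" by (rule complex_embedding) (rule that)
  have h0: "h 0 = 0" using h(2)[of 0 0] by simp
  interpret h: field_hom h by unfold_locales (simp_all add: h h0)
  define D where "D = map_mat h C"
  have Dc: "D \<in> carrier_mat n n" using Cc by (simp add: D_def)
  have Dadj: "mat_adjoint D = D"
  proof (rule eq_matI)
    fix i j assume "i < dim_row D" "j < dim_col D"
    hence ij: "i < n" "j < n" using Dc by auto
    have "conjugate (C $$ (j,i)) = C $$ (i,j)"
      using C ij Cc adjoint_index[of i C j] by (auto simp: hermitian_mat_def)
    hence "cnj (h (C $$ (j,i))) = h (C $$ (i,j))" by (metis h(4))
    thus "mat_adjoint D $$ (i,j) = D $$ (i,j)" using ij Dc Cc by (simp add: D_def)
  qed (use Dc in auto)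
  obtain z where "eigenvalue D z"
    using spectrum_non_empty[OF Dc n] by (auto simp: spectrum_def)
  then obtain w where w: "w \<in> carrier_vec n" "w \<noteq> 0\<^sub>v n" "D *\<^sub>v w = z \<cdot>\<^sub>v w"
    using Dc by (auto simp: eigenvalue_def eigenvector_def)
  have "(D *\<^sub>v w) \<bullet>c w = w \<bullet>c (D *\<^sub>v w)"
    using cscalar_adjoint[OF Dc w(1) w(1)] unfolding Dadj .
  hence "z * (w \<bullet>c w) = cnj z * (w \<bullet>c w)"
    using w by (simp add: conjugate_smult_vec)
  moreover have "w \<bullet>c w \<noteq> 0" using conjugate_square_eq_0_vec[OF w(1)] w(2) by simp
  ultimately have "cnj z = z" by simp
  hence z: "z = complex_of_real (Re z)" by (simp add: complex_eq_iff)
  have ch: "char_matrix D z = map_mat h (char_matrix C (of_real (Re z)))"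
    using Cc by (intro eq_matI)
      (auto simp: char_matrix_def D_def h.hom_minus h(5) z[symmetric])
  have "det (char_matrix D z) = 0" using \<open>eigenvalue D z\<close> eigenvalue_det[OF Dc] by simp
  hence "h (det (char_matrix C (of_real (Re z)))) = 0" unfolding ch by simp
  hence "eigenvalue C (of_real (Re z))" unfolding eigenvalue_det[OF Cc] by simp
  then obtain v where "v \<in> carrier_vec n" "v \<noteq> 0\<^sub>v n" "C *\<^sub>v v = of_real (Re z) \<cdot>\<^sub>v v"
    using Cc by (auto simp: eigenvalue_def eigenvector_def)
  thus thesis by (rule that)
qed

text \<open>The columns of \<open>P\<close> are an \<open>A\<close>-orthonormal basis of eigenvectors, and \<open>l\<close> lists the eigenvalues in the
order of the columns.\<close>

locale diagonalized_pencil =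
  fixes n :: nat and A B P :: "'a::real_or_complex mat" and l :: "nat \<Rightarrow> real"
  assumes A: "A \<in> carrier_mat n n" and B: "B \<in> carrier_mat n n" and P: "P \<in> carrier_mat n n"
    and congA: "mat_adjoint P * A * P = 1\<^sub>m n"
    and congB: "mat_adjoint P * B * P = mat_diag n (\<lambda>i. of_real (l i))"
begin

lemma P': "mat_adjoint P \<in> carrier_mat n n" by (rule adjoint_carrier[OF P])

lemma right_inverse: "P * (mat_adjoint P * A) = 1\<^sub>m n"
  by (rule mat_mult_left_right_inverse[OF mult_carrier_mat[OF P' A] P congA])

lemma adjoint_inverse: "A * P * mat_adjoint P = 1\<^sub>m n"
  by (rule mat_mult_left_right_inverse[OF P' mult_carrier_mat[OF A P]])
    (use assoc_mult_mat[OF P' A P] congA in simp)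

definition coord :: "'a vec \<Rightarrow> 'a vec" where "coord z = mat_adjoint P *\<^sub>v (A *\<^sub>v z)"

lemma coord_carrier: "z \<in> carrier_vec n \<Longrightarrow> coord z \<in> carrier_vec n"
  unfolding coord_def by (rule mult_mat_vec_carrier[OF P' mult_mat_vec_carrier[OF A]])

lemma P_coord: assumes z: "z \<in> carrier_vec n" shows "P *\<^sub>v coord z = z"
proof -
  have "P *\<^sub>v coord z = (P * (mat_adjoint P * A)) *\<^sub>v z"
    unfolding coord_def assoc_mult_mat_vec[OF P mult_carrier_mat[OF P' A] z]
      assoc_mult_mat_vec[OF P' A z] ..
  thus ?thesis using z by (simp add: right_inverse)
qed

lemma coord_P: "z \<in> carrier_vec n \<Longrightarrow> coord (P *\<^sub>v z) = z"
  unfolding coord_def using congruence_mult_vec[OF A P, of z] congA by simp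

lemma adjoint_P_B: "z \<in> carrier_vec n \<Longrightarrow> mat_adjoint P *\<^sub>v (B *\<^sub>v z) = mat_diag n (\<lambda>i. of_real (l i)) *\<^sub>v coord z"
  using congruence_mult_vec[OF B P coord_carrier[of z]] congB P_coord[of z] by simp

lemma adjoint_P_B_index: "z \<in> carrier_vec n \<Longrightarrow> i < n \<Longrightarrow>
    (mat_adjoint P *\<^sub>v (B *\<^sub>v z)) $ i = of_real (l i) * coord z $ i"
  unfolding adjoint_P_B by (rule mat_diag_mult_vec_index[OF coord_carrier])

lemma adjoint_P_inj:
  assumes w: "w \<in> carrier_vec n" "w' \<in> carrier_vec n" and eq: "mat_adjoint P *\<^sub>v w = mat_adjoint P *\<^sub>v w'"
  shows "w = w'"
proof -
  have *: "(A * P) *\<^sub>v (mat_adjoint P *\<^sub>v u) = u" if "u \<in> carrier_vec n" for u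
    using assoc_mult_mat_vec[OF mult_carrier_mat[OF A P] P' that] adjoint_inverse that by simp
  have "w = (A * P) *\<^sub>v (mat_adjoint P *\<^sub>v w)" by (rule *[OF w(1), symmetric])
  also have "\<dots> = w'" unfolding eq by (rule *[OF w(2)])
  finally show ?thesis .
qed

lemma quad_form_A: assumes z: "z \<in> carrier_vec n" shows "quad_form A z = (\<Sum>i<n. (norm (coord z $ i))\<^sup>2)"
  using quad_form_congruence[OF A P coord_carrier[OF z]] quad_form_one[OF coord_carrier[OF z]]
  by (simp add: congA P_coord[OF z])

lemma quad_form_B: assumes z: "z \<in> carrier_vec n" shows "quad_form B z = (\<Sum>i<n. l i * (norm (coord z $ i))\<^sup>2)"
  using quad_form_congruence[OF B P coord_carrier[OF z]] quad_form_mat_diag[OF coord_carrier[OF z], of l]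
  by (simp add: congB P_coord[OF z])

lemma eigen_iff:
  assumes z: "z \<in> carrier_vec n"
  shows "B *\<^sub>v z = of_real \<mu> \<cdot>\<^sub>v (A *\<^sub>v z) \<longleftrightarrow> (\<forall>i<n. coord z $ i = 0 \<or> l i = \<mu>)"
proof -
  have c: "B *\<^sub>v z \<in> carrier_vec n" "A *\<^sub>v z \<in> carrier_vec n" "of_real \<mu> \<cdot>\<^sub>v (A *\<^sub>v z) \<in> carrier_vec n"
    "mat_adjoint P *\<^sub>v (B *\<^sub>v z) \<in> carrier_vec n"
    using mult_mat_vec_carrier[OF B z] mult_mat_vec_carrier[OF A z]
      mult_mat_vec_carrier[OF P' mult_mat_vec_carrier[OF B z]] by simp_all
  have "B *\<^sub>v z = of_real \<mu> \<cdot>\<^sub>v (A *\<^sub>v z) \<longleftrightarrow>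
      mat_adjoint P *\<^sub>v (B *\<^sub>v z) = mat_adjoint P *\<^sub>v (of_real \<mu> \<cdot>\<^sub>v (A *\<^sub>v z))"
    by (rule iffI[OF arg_cong adjoint_P_inj[OF c(1,3)]])
  also have "mat_adjoint P *\<^sub>v (of_real \<mu> \<cdot>\<^sub>v (A *\<^sub>v z)) = of_real \<mu> \<cdot>\<^sub>v coord z"
    unfolding coord_def by (rule mult_mat_vec[OF P' c(2)])
  also have "mat_adjoint P *\<^sub>v (B *\<^sub>v z) = of_real \<mu> \<cdot>\<^sub>v coord z \<longleftrightarrow>
      (\<forall>i<n. (mat_adjoint P *\<^sub>v (B *\<^sub>v z)) $ i = of_real \<mu> * coord z $ i)"
    using c(4) coord_carrier[OF z] carrier_matD[OF P] by (auto simp: vec_eq_iff)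
  also have "\<dots> \<longleftrightarrow> (\<forall>i<n. coord z $ i = 0 \<or> l i = \<mu>)"
    using adjoint_P_B_index[OF z] by auto
  finally show ?thesis .
qed

lemma coord_index_add:
  assumes "x \<in> carrier_vec n" "y \<in> carrier_vec n" "i < n"
  shows "coord (x + y) $ i = coord x $ i + coord y $ i"
proof -
  have "coord (x + y) = coord x + coord y"
    unfolding coord_def mult_add_distrib_mat_vec[OF A assms(1,2)]
    by (rule mult_add_distrib_mat_vec[OF P' mult_mat_vec_carrier[OF A assms(1)] mult_mat_vec_carrier[OF A assms(2)]])
  thus ?thesis using coord_carrier[OF assms(1)] coord_carrier[OF assms(2)] assms(3) by simp
qed

lemma coord_index_smult:
  assumes "x \<in> carrier_vec n" "i < n"
  shows "coord (c \<cdot>\<^sub>v x) $ i = c * coord x $ i"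
proof -
  have "coord (c \<cdot>\<^sub>v x) = c \<cdot>\<^sub>v coord x"
    unfolding coord_def mult_mat_vec[OF A assms(1)]
    by (rule mult_mat_vec[OF P' mult_mat_vec_carrier[OF A assms(1)]])
  thus ?thesis using coord_carrier[OF assms(1)] assms(2) by simp
qed

lemma coord_index_minus:
  assumes "x \<in> carrier_vec n" "y \<in> carrier_vec n" "i < n"
  shows "coord (x - y) $ i = coord x $ i - coord y $ i"
proof -
  have "coord (x - y) = coord x - coord y"
    unfolding coord_def mult_minus_distrib_mat_vec[OF A assms(1,2)]
    by (rule mult_minus_distrib_mat_vec[OF P' mult_mat_vec_carrier[OF A assms(1)] mult_mat_vec_carrier[OF A assms(2)]])
  thus ?thesis using coord_carrier[OF assms(1)] coord_carrier[OF assms(2)] assms(3) by simp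
qed

lemma coord_nonzero:
  assumes x: "x \<in> carrier_vec n" "x \<noteq> 0\<^sub>v n" shows "0 < (\<Sum>i<n. (norm (coord x $ i))\<^sup>2)"
proof -
  have "\<exists>i<n. coord x $ i \<noteq> 0"
  proof (rule ccontr)
    assume "\<not> (\<exists>i<n. coord x $ i \<noteq> 0)"
    hence "coord x = 0\<^sub>v n" using coord_carrier[OF x(1)] by (intro eq_vecI) auto
    hence "x = P *\<^sub>v 0\<^sub>v n" using P_coord[OF x(1)] by simp
    also have "\<dots> = 0\<^sub>v n" using P by (intro eq_vecI) (auto simp: scalar_prod_def)
    finally show False using x(2) by simp
  qed
  thus ?thesis by (auto intro!: sum_pos2)
qed

end

text \<open>An eigenvector of \<open>R\<^sup>* B R\<close>, where \<open>R\<^sup>* A R = 1\<close>, is mapped by \<open>R\<close> to an eigenvector of the pencil. The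
induction continues on its \<open>A\<close>-orthogonal complement.\<close>

lemma pencil_diagonalizable:
  fixes A :: "'a::real_or_complex mat"
  assumes "pos_def_mat n A" "hermitian_mat n B"
  shows "\<exists>P l. diagonalized_pencil n A B P l"
  using assms
proof (induction n arbitrary: A B)
  case 0
  have "diagonalized_pencil 0 A B (1\<^sub>m 0) (\<lambda>_. 0)"
    using 0 by unfold_locales
      (auto intro!: eq_matI simp: mat_diag_def dest!: pos_def_hermitian hermitian_carrier)
  thus ?case by blast
next
  case (Suc n)
  note Ah = pos_def_hermitian[OF Suc.prems(1)] and Ac = hermitian_carrier[OF pos_def_hermitian[OF Suc.prems(1)]]
    and Bh = Suc.prems(2) and Bc = hermitian_carrier[OF Suc.prems(2)]
  obtain R where R: "R \<in> carrier_mat (Suc n) (Suc n)" "mat_adjoint R * A * R = 1\<^sub>m (Suc n)"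
    using pos_def_congruent_one[OF Suc.prems(1)] by blast
  obtain \<mu> y where y: "y \<in> carrier_vec (Suc n)" "y \<noteq> 0\<^sub>v (Suc n)" "(mat_adjoint R * B * R) *\<^sub>v y = of_real \<mu> \<cdot>\<^sub>v y"
    using hermitian_eigenpair[OF hermitian_congruence[OF Bh R(1)]] by blast
  note R' = adjoint_carrier[OF R(1)]
  define u where "u = R *\<^sub>v y"
  have u: "u \<in> carrier_vec (Suc n)" unfolding u_def by (rule mult_mat_vec_carrier[OF R(1) y(1)])
  have RAu: "mat_adjoint R *\<^sub>v (A *\<^sub>v u) = y"
    unfolding u_def using congruence_mult_vec[OF Ac R(1) y(1)] R(2) y(1) by simp
  have u0: "u \<noteq> 0\<^sub>v (Suc n)"
  proof
    assume "u = 0\<^sub>v (Suc n)"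
    hence "y = mat_adjoint R *\<^sub>v (A *\<^sub>v 0\<^sub>v (Suc n))" using RAu by simp
    also have "\<dots> = 0\<^sub>v (Suc n)" using Ac R(1) by (intro eq_vecI) (auto simp: scalar_prod_def)
    finally show False using y(2) by simp
  qed
  have Bu: "B *\<^sub>v u = of_real \<mu> \<cdot>\<^sub>v (A *\<^sub>v u)"
  proof -
    have inv: "A * R * mat_adjoint R = 1\<^sub>m (Suc n)"
      by (rule mat_mult_left_right_inverse[OF R' mult_carrier_mat[OF Ac R(1)]])
        (use assoc_mult_mat[OF R' Ac R(1)] R(2) in simp)
    have *: "(A * R) *\<^sub>v (mat_adjoint R *\<^sub>v w) = w" if "w \<in> carrier_vec (Suc n)" for w
      using assoc_mult_mat_vec[OF mult_carrier_mat[OF Ac R(1)] R' that] inv that by simp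
    have "mat_adjoint R *\<^sub>v (B *\<^sub>v u) = of_real \<mu> \<cdot>\<^sub>v y"
      unfolding u_def using congruence_mult_vec[OF Bc R(1) y(1)] y(3) by simp
    hence "mat_adjoint R *\<^sub>v (B *\<^sub>v u) = mat_adjoint R *\<^sub>v (of_real \<mu> \<cdot>\<^sub>v (A *\<^sub>v u))"
      using mult_mat_vec[OF R' mult_mat_vec_carrier[OF Ac u]] RAu by simp
    hence "(A * R) *\<^sub>v (mat_adjoint R *\<^sub>v (B *\<^sub>v u)) =
        (A * R) *\<^sub>v (mat_adjoint R *\<^sub>v (of_real \<mu> \<cdot>\<^sub>v (A *\<^sub>v u)))" by (rule arg_cong)
    thus ?thesis
      unfolding *[OF mult_mat_vec_carrier[OF Bc u]] *[OF smult_carrier_vec[THEN iffD2, OF mult_mat_vec_carrier[OF Ac u]]] .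
  qed
  obtain c Q where cQ: "(A *\<^sub>v (of_real c \<cdot>\<^sub>v u)) \<bullet>c (of_real c \<cdot>\<^sub>v u) = 1" "Q \<in> carrier_mat (Suc n) n"
    "mat_adjoint Q *\<^sub>v (A *\<^sub>v (of_real c \<cdot>\<^sub>v u)) = 0\<^sub>v n" "pos_def_mat n (mat_adjoint Q * A * Q)"
    using deflation[OF Suc.prems(1) u u0] by blast
  define v where "v = of_real c \<cdot>\<^sub>v u"
  have v: "v \<in> carrier_vec (Suc n)" using u by (simp add: v_def)
  have Bv: "B *\<^sub>v v = of_real \<mu> \<cdot>\<^sub>v (A *\<^sub>v v)"
    unfolding v_def mult_mat_vec[OF Bc u] mult_mat_vec[OF Ac u] Bu by (simp add: smult_smult_assoc mult.commute)
  obtain P l where "diagonalized_pencil n (mat_adjoint Q * A * Q) (mat_adjoint Q * B * Q) P l"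
    using Suc.IH[OF cQ(4) hermitian_congruence[OF Bh cQ(2)]] by blast
  then interpret sub: diagonalized_pencil n "mat_adjoint Q * A * Q" "mat_adjoint Q * B * Q" P l .
  have QP: "Q * P \<in> carrier_mat (Suc n) n" by (rule mult_carrier_mat[OF cQ(2) sub.P])
  have orth: "mat_adjoint (Q * P) *\<^sub>v (A *\<^sub>v v) = 0\<^sub>v n"
    by (rule adjoint_mult_orth[OF cQ(2) sub.P mult_mat_vec_carrier[OF Ac v] cQ(3)[folded v_def]])
  have dA: "mat_adjoint (Q * P) * A * (Q * P) = mat_diag n (\<lambda>i. of_real 1)"
    unfolding congruence_mult[OF Ac cQ(2) sub.P] sub.congA one_mat_diag ..
  have dB: "mat_adjoint (Q * P) * B * (Q * P) = mat_diag n (\<lambda>i. of_real (l i))"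
    unfolding congruence_mult[OF Bc cQ(2) sub.P] by (rule sub.congB)
  have Av: "A *\<^sub>v v = of_real 1 \<cdot>\<^sub>v (A *\<^sub>v v)" by simp
  define N where "N = mat_of_cols (Suc n) (v # cols (Q * P))"
  have "mat_adjoint N * A * N = mat_diag (Suc n) (\<lambda>i. of_real (case_nat 1 (\<lambda>_. 1) i))"
    unfolding N_def by (rule bordered_congruence[OF Ah Ah v cQ(1)[folded v_def] Av QP orth dA])
  also have "\<dots> = 1\<^sub>m (Suc n)" by (auto simp: mat_diag_def split: nat.splits)
  finally have NA: "mat_adjoint N * A * N = 1\<^sub>m (Suc n)" .
  have NB: "mat_adjoint N * B * N = mat_diag (Suc n) (\<lambda>i. of_real (case_nat \<mu> l i))"
    unfolding N_def by (rule bordered_congruence[OF Ah Bh v cQ(1)[folded v_def] Bv QP orth dB])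
  have "N \<in> carrier_mat (Suc n) (Suc n)" unfolding N_def by (rule bordered_carrier[OF QP])
  hence "diagonalized_pencil (Suc n) A B N (case_nat \<mu> l)"
    using NA NB Ac Bc by unfold_locales auto
  thus ?case by blast
qed

section \<open>The ordered list of eigenvalues\<close>

context diagonalized_pencil begin

lemma spectrum: "pencil_spectrum A B = l ` {..<n}"
proof (intro equalityI subsetI)
  fix \<mu> assume "\<mu> \<in> pencil_spectrum A B"
  then obtain v where v: "v \<in> carrier_vec n" "v \<noteq> 0\<^sub>v n" "B *\<^sub>v v = of_real \<mu> \<cdot>\<^sub>v (A *\<^sub>v v)"
    using A by (auto simp: pencil_spectrum_def)
  have "coord v \<noteq> 0\<^sub>v n"
  proof
    assume "coord v = 0\<^sub>v n"
    hence "v = P *\<^sub>v 0\<^sub>v n" using P_coord[OF v(1)] by simp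
    thus False using v P by (auto simp: vec_eq_iff scalar_prod_def)
  qed
  then obtain i where "i < n" "coord v $ i \<noteq> 0"
    using coord_carrier[OF v(1)] by (auto simp: vec_eq_iff)
  thus "\<mu> \<in> l ` {..<n}" using v(3) unfolding eigen_iff[OF v(1)] by auto
next
  fix \<mu> assume "\<mu> \<in> l ` {..<n}"
  then obtain i where i: "i < n" "\<mu> = l i" by auto
  define v where "v = P *\<^sub>v unit_vec n i"
  have v: "v \<in> carrier_vec n" unfolding v_def by (rule mult_mat_vec_carrier[OF P]) simp
  have cv: "coord v = unit_vec n i" unfolding v_def by (rule coord_P) simp
  have "v \<noteq> 0\<^sub>v n"
  proof
    assume "v = 0\<^sub>v n"
    hence "coord v $ i = 0"
      using mult_mat_vec_carrier[OF A v] A P i unfolding coord_def by (simp add: scalar_prod_def)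
    thus False using cv i by simp
  qed
  moreover have "B *\<^sub>v v = of_real \<mu> \<cdot>\<^sub>v (A *\<^sub>v v)" unfolding eigen_iff[OF v] cv using i by auto
  ultimately show "\<mu> \<in> pencil_spectrum A B" using v A by (auto simp: pencil_spectrum_def)
qed

end

text \<open>A diagonal matrix is a Jordan matrix with blocks of size one, so that the known dimension of
generalized eigenspaces of Jordan matrices gives the dimension of its kernel.\<close>

lemma jordan_matrix_diag: "jordan_matrix (map (\<lambda>j. (1, f j)) [0..<n]) = mat_diag n f"
proof (induction n arbitrary: f)
  case 0
  thus ?case by (auto simp: jordan_matrix_def mat_diag_def)
next
  case (Suc n)
  have "map (\<lambda>j. (1::nat, f j)) [0..<Suc n] = (1, f 0) # map (\<lambda>j. (1, f (Suc j))) [0..<n]"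
    by (simp add: upt_conv_Cons map_Suc_upt[symmetric] o_def del: upt_Suc)
  moreover have "sum_list (map fst (map (\<lambda>j. (1::nat, f (Suc j))) [0..<n])) = n"
    by (simp add: o_def sum_list_triv)
  ultimately have "jordan_matrix (map (\<lambda>j. (1, f j)) [0..<Suc n]) = four_block_mat (jordan_block 1 (f 0))
      (0\<^sub>m 1 n) (0\<^sub>m n 1) (mat_diag n (\<lambda>j. f (Suc j)))"
    by (simp only: jordan_matrix_Cons Suc.IH[of "\<lambda>j. f (Suc j)"])
  also have "\<dots> = mat_diag (Suc n) f" by (rule eq_matI) (auto simp: mat_diag_def)
  finally show ?case .
qed

lemma kernel_dim_mat_diag: "kernel_dim (mat_diag n (f :: nat \<Rightarrow> 'a::field)) = card {j. j < n \<and> f j = 0}"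
proof -
  have "char_matrix (mat_diag n f) 0 ^\<^sub>m 1 = mat_diag n f"
    by (rule eq_matI) (auto simp: char_matrix_def mat_diag_def)
  hence "kernel_dim (mat_diag n f) = dim_gen_eigenspace (jordan_matrix (map (\<lambda>j. (1, f j)) [0..<n])) 0 1"
    unfolding dim_gen_eigenspace_def jordan_matrix_diag by (simp only:)
  also have "\<dots> = length (filter (\<lambda>j. f j = 0) [0..<n])"
    unfolding dim_gen_eigenspace_jordan_matrix
    by (simp add: filter_map o_def sum_list_triv case_prod_beta)
  also have "\<dots> = card {j. j < n \<and> f j = 0}"
    by (simp add: length_filter_conv_card cong: conj_cong)
  finally show ?thesis .
qed

context diagonalized_pencil begin

lemma kernel_dim_pencil: "kernel_dim (B - of_real \<mu> \<cdot>\<^sub>m A) = card {j. j < n \<and> l j = \<mu>}"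
proof -
  define X where "X = B - of_real \<mu> \<cdot>\<^sub>m A"
  have X: "X \<in> carrier_mat n n" unfolding X_def by (rule minus_carrier_mat[OF smult_carrier_mat[OF A]])
  have "mat_adjoint P * X * P = mat_adjoint P * B * P - of_real \<mu> \<cdot>\<^sub>m (mat_adjoint P * A * P)"
  proof -
    have "mat_adjoint P * X = mat_adjoint P * B - mat_adjoint P * (of_real \<mu> \<cdot>\<^sub>m A)"
      unfolding X_def by (rule mult_minus_distrib_mat[OF P' B]) (use A in simp)
    also have "mat_adjoint P * (of_real \<mu> \<cdot>\<^sub>m A) = of_real \<mu> \<cdot>\<^sub>m (mat_adjoint P * A)"
      by (rule mult_smult_distrib[OF P' A])
    finally have "mat_adjoint P * X * P = mat_adjoint P * B * P - of_real \<mu> \<cdot>\<^sub>m (mat_adjoint P * A) * P"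
      using minus_mult_distrib_mat[OF mult_carrier_mat[OF P' B] smult_carrier_mat[OF mult_carrier_mat[OF P' A]] P]
      by simp
    thus ?thesis using mult_smult_assoc_mat[OF mult_carrier_mat[OF P' A] P] by simp
  qed
  also have "\<dots> = mat_diag n (\<lambda>i. of_real (l i - \<mu>))"
    unfolding congA congB by (rule eq_matI) (auto simp: mat_diag_def)
  finally have diag: "mat_adjoint P * X * P = mat_diag n (\<lambda>i. of_real (l i - \<mu>))" .
  have "kernel.dim n X = kernel.dim n (mat_adjoint P * X)"
    unfolding mat_kernel_mult_eq[OF X P' mult_carrier_mat[OF A P] adjoint_inverse] ..
  also have "\<dots> = kernel.dim n (mat_adjoint P * X * P)"
    by (rule mat_kernel_dim_mult_eq_right[symmetric, OF mult_carrier_mat[OF P' X] P mult_carrier_mat[OF P' A] right_inverse])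
  finally have "kernel_dim X = kernel_dim (mat_diag n (\<lambda>i. of_real (l i - \<mu>) :: 'a))"
    unfolding kernel_dim_def diag using X by (simp add: mat_diag_def)
  thus ?thesis unfolding X_def kernel_dim_mat_diag by simp
qed

end

lemma sorted_concat_replicate:
  "sorted S \<Longrightarrow> sorted (concat (map (\<lambda>x. replicate (k x) x) S))"
  by (induction S) (auto simp: sorted_append)

lemma count_concat_replicate:
  "distinct S \<Longrightarrow> count (mset (concat (map (\<lambda>x. replicate (k x) x) S))) y = (if y \<in> set S then k y else 0)"
  by (induction S) auto

lemma count_map_upt: "count (mset (map l [0..<n])) y = card {j. j < n \<and> l j = y}"
proof -
  have "count (mset (map l [0..<n])) y = length (filter (\<lambda>j. l j = y) [0..<n])"
    by (induction n) auto
  thus ?thesis by (simp add: length_filter_conv_card cong: conj_cong)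
qed

context diagonalized_pencil begin

text \<open>The list with multiplicities is thus the descending rearrangement of \<open>l\<close>. In particular it has length
\<open>n\<close>, so the indices in the convergence estimate stay inside the list.\<close>

lemma eigvals: "pencil_eigvals A B = rev (sort (map l [0..<n]))"
proof -
  define k where "k \<mu> = card {j. j < n \<and> l j = \<mu>}" for \<mu>
  define S where "S = sorted_list_of_set (l ` {..<n})"
  have "rev (pencil_eigvals A B) = concat (map (\<lambda>\<mu>. replicate (k \<mu>) \<mu>) S)"
    unfolding pencil_eigvals_def kernel_dim_pencil spectrum k_def[symmetric] S_def[symmetric]
    by (simp add: rev_concat rev_map o_def)
  also have "\<dots> = sort (map l [0..<n])"
  proof (rule properties_for_sort[symmetric])
    show "sorted (concat (map (\<lambda>\<mu>. replicate (k \<mu>) \<mu>) S))"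
      by (rule sorted_concat_replicate) (simp add: S_def)
    show "mset (concat (map (\<lambda>\<mu>. replicate (k \<mu>) \<mu>) S)) = mset (map l [0..<n])"
    proof (rule multiset_eqI)
      fix y
      have "count (mset (concat (map (\<lambda>\<mu>. replicate (k \<mu>) \<mu>) S))) y = (if y \<in> set S then k y else 0)"
        by (rule count_concat_replicate) (simp add: S_def)
      also have "\<dots> = k y" by (auto simp: S_def k_def)
      finally show "count (mset (concat (map (\<lambda>\<mu>. replicate (k \<mu>) \<mu>) S))) y = count (mset (map l [0..<n])) y"
        by (simp only: count_map_upt k_def)
    qed
  qed
  finally show ?thesis by (metis rev_rev_ident)
qed

end

section \<open>The convergence estimate\<close>

lemma pos_def_inverse:
  fixes T :: "'a::real_or_complex mat"
  assumes T: "pos_def_mat n T"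
  obtains S where "mat_inverse T = Some S" "hermitian_mat n S" "S * T = 1\<^sub>m n" "T * S = 1\<^sub>m n"
proof -
  note Tc = hermitian_carrier[OF pos_def_hermitian[OF T]]
  have "det T \<noteq> 0"
  proof
    assume "det T = 0"
    then obtain z where z: "z \<in> carrier_vec n" "z \<noteq> 0\<^sub>v n" "T *\<^sub>v z = 0\<^sub>v n"
      using det_0_iff_vec_prod_zero[OF Tc] by blast
    hence "quad_form T z = 0" by (simp add: quad_form_def)
    thus False using T z by (auto simp: pos_def_mat_def)
  qed
  hence "T \<in> Units (ring_mat TYPE('a) n ())"
    by (rule det_non_zero_imp_unit[OF Tc])
  then obtain S where S: "mat_inverse T = Some S"
    using mat_inverse(1)[OF Tc, where b = "()"] by (cases "mat_inverse T") auto
  have TS: "T * S = 1\<^sub>m n" "S * T = 1\<^sub>m n" and Sc: "S \<in> carrier_mat n n"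
    using mat_inverse(2)[OF Tc S] by auto
  have "mat_adjoint S * T = 1\<^sub>m n"
  proof -
    have "mat_adjoint S * T = mat_adjoint S * mat_adjoint T"
      using T by (simp add: pos_def_mat_def hermitian_mat_def)
    also have "\<dots> = mat_adjoint (T * S)" by (rule adjoint_mult[OF Tc Sc, symmetric])
    also have "\<dots> = 1\<^sub>m n" unfolding TS by (rule eq_matI) auto
    finally show ?thesis .
  qed
  hence "mat_adjoint S * T * S = S" using Sc by simp
  hence "mat_adjoint S * (T * S) = S" by (simp only: assoc_mult_mat[OF adjoint_carrier[OF Sc] Tc Sc])
  hence "mat_adjoint S = S" unfolding TS using right_mult_one_mat[OF adjoint_carrier[OF Sc]] by simp
  hence "hermitian_mat n S" using Sc by (simp add: hermitian_mat_def)
  thus thesis using that[OF S _ TS(2,1)] by blast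
qed

text \<open>With \<open>S = T\<^sup>-\<^sup>1\<close> and \<open>A u = r\<close>, the vector \<open>t = T r\<close> solves \<open>S t = A u\<close>, so the claim is that the
\<open>A\<close>-norm of \<open>I - T A\<close> is at most \<open>\<gamma>\<close>. The eigenvalues \<open>\<tau>\<close> of the pencil \<open>S - \<tau> A\<close>
satisfy \<open>(1 - \<gamma>) \<tau> \<le> 1 \<le> (1 + \<gamma>) \<tau>\<close>, which is \<open>\<bar>1 - \<tau>\<bar> \<le> \<gamma> \<tau>\<close>, and in its eigenbasis
\<open>t - u\<close> has the coordinates of \<open>u\<close> multiplied by \<open>(1 - \<tau>) / \<tau>\<close>.\<close>

lemma preconditioner_ball:
  fixes A S :: "'a::real_or_complex mat"
  assumes A: "pos_def_mat n A" and S: "hermitian_mat n S"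
    and bounds: "\<And>z. z \<in> carrier_vec n \<Longrightarrow> (1 - \<gamma>) * quad_form S z \<le> quad_form A z"
      "\<And>z. z \<in> carrier_vec n \<Longrightarrow> quad_form A z \<le> (1 + \<gamma>) * quad_form S z"
    and t: "t \<in> carrier_vec n" and u: "u \<in> carrier_vec n" and eq: "S *\<^sub>v t = A *\<^sub>v u"
  shows "quad_form A (t - u) \<le> \<gamma>\<^sup>2 * quad_form A u"
proof -
  obtain P \<tau> where "diagonalized_pencil n A S P \<tau>" using pencil_diagonalizable[OF A S] by blast
  then interpret diagonalized_pencil n A S P \<tau> .
  have \<tau>: "\<bar>1 - \<tau> i\<bar> \<le> \<bar>\<gamma> * \<tau> i\<bar>" if i: "i < n" for i
  proof -
    define z where "z = P *\<^sub>v unit_vec n i"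
    have z: "z \<in> carrier_vec n" unfolding z_def by (rule mult_mat_vec_carrier[OF P]) simp
    have cz: "coord z = unit_vec n i" unfolding z_def by (rule coord_P) simp
    have pick: "(\<Sum>j<n. w j * (norm (unit_vec n i $ j :: 'a))\<^sup>2) = w i" for w :: "nat \<Rightarrow> real"
    proof -
      have "(\<Sum>j<n. w j * (norm (unit_vec n i $ j :: 'a))\<^sup>2) = (\<Sum>j<n. if j = i then w j else 0)"
        using i norm_of_real_eq[of 1, where 'a='a] by (intro sum.cong) auto
      thus ?thesis using i by simp
    qed
    have "quad_form A z = 1" "quad_form S z = \<tau> i"
      unfolding quad_form_A[OF z] quad_form_B[OF z] cz using pick[of "\<lambda>_. 1"] pick[of \<tau>] by simp_all
    hence "(1 - \<gamma>) * \<tau> i \<le> 1" "1 \<le> (1 + \<gamma>) * \<tau> i" using bounds[OF z] by auto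
    thus ?thesis by (auto simp: algebra_simps)
  qed
  have tu: "of_real (\<tau> i) * coord t $ i = coord u $ i" if "i < n" for i
    using adjoint_P_B_index[OF t that] eq by (simp add: coord_def)
  have "quad_form A (t - u) = (\<Sum>i<n. (norm (coord t $ i - coord u $ i))\<^sup>2)"
    using t u by (subst quad_form_A) (auto simp: coord_index_minus)
  also have "\<dots> \<le> (\<Sum>i<n. \<gamma>\<^sup>2 * (norm (coord u $ i))\<^sup>2)"
  proof (rule sum_mono)
    fix i assume "i \<in> {..<n}"
    hence i: "i < n" by simp
    have "coord t $ i - coord u $ i = (1 - \<tau> i) *\<^sub>R coord t $ i"
      using tu[OF i] by (simp add: scaleR_conv_of_real left_diff_distrib)
    hence "norm (coord t $ i - coord u $ i) = \<bar>1 - \<tau> i\<bar> * norm (coord t $ i)" by simp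
    also have "\<dots> \<le> \<bar>\<gamma> * \<tau> i\<bar> * norm (coord t $ i)"
      by (rule mult_right_mono[OF \<tau>[OF i]]) simp
    also have "\<dots> = \<bar>\<gamma>\<bar> * norm (coord u $ i)"
      unfolding tu[OF i, symmetric] by (simp add: abs_mult flip: scaleR_conv_of_real)
    finally have "(norm (coord t $ i - coord u $ i))\<^sup>2 \<le> (\<bar>\<gamma>\<bar> * norm (coord u $ i))\<^sup>2"
      by (rule power_mono) simp
    thus "(norm (coord t $ i - coord u $ i))\<^sup>2 \<le> \<gamma>\<^sup>2 * (norm (coord u $ i))\<^sup>2"
      by (simp add: power_mult_distrib)
  qed
  also have "\<dots> = \<gamma>\<^sup>2 * quad_form A u"
    by (simp add: quad_form_A[OF u] sum_distrib_left)
  finally show ?thesis .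
qed

text \<open>In the eigenbasis the residual has coordinates \<open>(\<lambda>\<^sub>j - \<kappa>) \<xi>\<^sub>j\<close>, so the ball lemma bounds the distance of
\<open>k x'\<close> from the vector with coordinates \<open>(\<lambda>\<^sub>j - c) \<xi>\<^sub>j\<close>, where \<open>k = \<kappa> - c\<close> and \<open>c\<close> is the smallest
eigenvalue. By the triangle inequality the same bound holds for the absolute values of the
coordinates, and the certificate applies to these.\<close>

theorem prec_step_contraction:
  fixes A B T :: "'a::real_or_complex mat"
  assumes A: "pos_def_mat n A" and B: "hermitian_mat n B" and \<gamma>: "0 \<le> \<gamma>" "\<gamma> < 1"
    and T: "preconditioner n \<gamma> A T"
    and x: "x \<in> carrier_vec n" "x \<noteq> 0\<^sub>v n" and gt: "mu_min A B < rayleigh A B x"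
    and i: "1 \<le> i" "i \<le> n - 1"
    and between: "pencil_eigval A B (i + 1) < rayleigh A B x" "rayleigh A B x \<le> pencil_eigval A B i"
  shows "let x' = prec_step A B T x;
             \<mu> = pencil_eigval A B;
             \<sigma> = 1 - (1 - \<gamma>) * ((\<mu> i - \<mu> (i + 1)) / (\<mu> i - mu_min A B))
         in x' \<noteq> 0\<^sub>v n \<and>
            rayleigh A B x' \<ge> rayleigh A B x \<and>
            (\<mu> i - rayleigh A B x') / (rayleigh A B x' - \<mu> (i + 1))
              \<le> \<sigma>\<^sup>2 * ((\<mu> i - rayleigh A B x) / (rayleigh A B x - \<mu> (i + 1)))"
proof -
  obtain P l where "diagonalized_pencil n A B P l" using pencil_diagonalizable[OF A B] by blast
  then interpret D: diagonalized_pencil n A B P l .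
  define \<kappa> where "\<kappa> = rayleigh A B x"
  define c where "c = mu_min A B"
  define a where "a = pencil_eigval A B i"
  define b where "b = pencil_eigval A B (i + 1)"
  define x' where "x' = prec_step A B T x"
  define \<sigma> where "\<sigma> = 1 - (1 - \<gamma>) * ((a - b) / (a - c))"
  have n: "i < n" using i by simp
  define E where "E = pencil_eigvals A B"
  have lenE: "length E = n" and setE: "set E = l ` {..<n}"
    by (auto simp: E_def D.eigvals)
  \<comment> \<open>eigenvalues are numbered from \<open>1\<close>, list entries from \<open>0\<close>\<close>
  have desc: "E ! k \<le> E ! j" if "j \<le> k" "k < n" for j k
  proof -
    have "sorted (rev E)" by (simp add: E_def D.eigvals)
    thus ?thesis using that lenE sorted_rev_nth_mono[of E j k] by simp
  qed
  have aE: "a = E ! (i - 1)" and bE: "b = E ! i"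
    by (simp_all add: a_def b_def E_def pencil_eigval_def)
  have gap: "l j \<le> b \<or> a \<le> l j" if j: "j < n" for j
  proof -
    have "l j \<in> set E" using j setE by auto
    then obtain m where m: "m < n" "E ! m = l j" unfolding in_set_conv_nth lenE by blast
    show ?thesis
    proof (cases "m < i")
      case True
      thus ?thesis using desc[of m "i-1"] n m aE i by simp
    next
      case False
      thus ?thesis using desc[of i m] m bE by simp
    qed
  qed
  have c_le: "c \<le> l j" if "j < n" for j
    unfolding c_def mu_min_def D.spectrum using that by (intro Min_le) auto
  have "b \<in> set E" using n lenE bE by (metis nth_mem)
  hence cb: "c \<le> b" using c_le setE by auto
  have order: "c < \<kappa>" "b < \<kappa>" "\<kappa> \<le> a"
    using gt between by (auto simp: c_def \<kappa>_def a_def b_def)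
  \<comment> \<open>\<open>u\<close> is the residual with the exact inverse of \<open>A\<close> in place of \<open>T\<close>\<close>
  have Tp: "pos_def_mat n T" using T by (simp add: preconditioner_def)
  obtain S where S: "mat_inverse T = Some S" "hermitian_mat n S" "S * T = 1\<^sub>m n" "T * S = 1\<^sub>m n"
    by (rule pos_def_inverse[OF Tp])
  note Ac = D.A and Bc = D.B and Tc = hermitian_carrier[OF pos_def_hermitian[OF Tp]]
    and Sc = hermitian_carrier[OF S(2)]
  define r where "r = B *\<^sub>v x - of_real \<kappa> \<cdot>\<^sub>v (A *\<^sub>v x)"
  have Ax: "A *\<^sub>v x \<in> carrier_vec n" and Bx: "B *\<^sub>v x \<in> carrier_vec n"
    by (rule mult_mat_vec_carrier[OF Ac x(1)], rule mult_mat_vec_carrier[OF Bc x(1)])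
  have r: "r \<in> carrier_vec n" using Ax Bx by (simp add: r_def)
  define t where "t = T *\<^sub>v r"
  have t: "t \<in> carrier_vec n" unfolding t_def by (rule mult_mat_vec_carrier[OF Tc r])
  define u where "u = P *\<^sub>v (mat_adjoint P *\<^sub>v r)"
  have P'r: "mat_adjoint P *\<^sub>v r \<in> carrier_vec n" by (rule mult_mat_vec_carrier[OF D.P' r])
  have u: "u \<in> carrier_vec n" unfolding u_def by (rule mult_mat_vec_carrier[OF D.P P'r])
  have cu: "D.coord u = mat_adjoint P *\<^sub>v r" unfolding u_def by (rule D.coord_P[OF P'r])
  have Au: "A *\<^sub>v u = r"
    by (rule D.adjoint_P_inj[OF mult_mat_vec_carrier[OF Ac u] r]) (use cu in \<open>simp add: D.coord_def\<close>)
  have St: "S *\<^sub>v t = A *\<^sub>v u"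
    unfolding t_def Au using assoc_mult_mat_vec[OF Sc Tc r] S(3) r by simp
  have ballA: "quad_form A (t - u) \<le> \<gamma>\<^sup>2 * quad_form A u"
    by (rule preconditioner_ball[OF A S(2) _ _ t u St]) (use T S(1) in \<open>auto simp: preconditioner_def\<close>)
  define \<xi> where "\<xi> j = D.coord x $ j" for j
  define \<chi> where "\<chi> j = D.coord x' $ j" for j
  have cuj: "D.coord u $ j = (l j - \<kappa>) *\<^sub>R \<xi> j" if j: "j < n" for j
  proof -
    have "mat_adjoint P *\<^sub>v r = mat_adjoint P *\<^sub>v (B *\<^sub>v x) - of_real \<kappa> \<cdot>\<^sub>v D.coord x"
      unfolding r_def D.coord_def
      using mult_minus_distrib_mat_vec[OF D.P' Bx, of "of_real \<kappa> \<cdot>\<^sub>v (A *\<^sub>v x)"] mult_mat_vec[OF D.P' Ax] Ax by simp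
    hence "D.coord u $ j = of_real (l j) * \<xi> j - of_real \<kappa> * \<xi> j"
      unfolding cu \<xi>_def using j D.adjoint_P_B_index[OF x(1) j] D.coord_carrier[OF x(1)]
        mult_mat_vec_carrier[OF D.P' Bx] by simp
    thus ?thesis by (simp add: scaleR_conv_of_real left_diff_distrib)
  qed
  define k where "k = \<kappa> - c"
  have k: "k > 0" using order by (simp add: k_def)
  have x'_eq: "x' = x + of_real (1 / k) \<cdot>\<^sub>v t"
    by (simp add: x'_def prec_step_def t_def r_def k_def \<kappa>_def c_def)
  have x': "x' \<in> carrier_vec n" using x t by (simp add: x'_eq)
  have \<chi>: "k *\<^sub>R \<chi> j = k *\<^sub>R \<xi> j + D.coord t $ j" if j: "j < n" for j
    using x t j k by (simp add: \<chi>_def \<xi>_def x'_eq D.coord_index_add D.coord_index_smult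
        scaleR_conv_of_real distrib_left)
  define lam where "lam j = l j - c" for j
  define f where "f j = norm (\<xi> j)" for j
  define g where "g j = norm (k *\<^sub>R \<chi> j)" for j
  have N: "quad_form A x = (\<Sum>j<n. (f j)\<^sup>2)" "0 < (\<Sum>j<n. (f j)\<^sup>2)"
    using D.quad_form_A[OF x(1)] D.coord_nonzero[OF x] by (simp_all add: f_def \<xi>_def)
  have mean: "(\<Sum>j<n. (lam j - k) * (f j)\<^sup>2) = 0"
  proof -
    have "\<kappa> * (\<Sum>j<n. (f j)\<^sup>2) = quad_form B x" using N by (simp add: \<kappa>_def rayleigh_def)
    also have "\<dots> = (\<Sum>j<n. l j * (f j)\<^sup>2)" using D.quad_form_B[OF x(1)] by (simp add: f_def \<xi>_def)
    finally show ?thesis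
      by (simp add: lam_def k_def left_diff_distrib sum_subtractf sum_distrib_left)
  qed
  have ball: "(\<Sum>j<n. (g j - lam j * f j)\<^sup>2) \<le> \<gamma>\<^sup>2 * (\<Sum>j<n. ((lam j - k) * f j)\<^sup>2)"
  proof -
    have "(\<Sum>j<n. (g j - lam j * f j)\<^sup>2) \<le> (\<Sum>j<n. (norm (D.coord t $ j - D.coord u $ j))\<^sup>2)"
    proof (rule sum_mono)
      fix j assume "j \<in> {..<n}"
      hence j: "j < n" by simp
      have "lam j * f j = norm (lam j *\<^sub>R \<xi> j)" using c_le[OF j] by (simp add: f_def lam_def)
      hence "\<bar>g j - lam j * f j\<bar> \<le> norm (k *\<^sub>R \<chi> j - lam j *\<^sub>R \<xi> j)"
        unfolding g_def by (simp only: norm_triangle_ineq3)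
      also have "k *\<^sub>R \<chi> j - lam j *\<^sub>R \<xi> j = D.coord t $ j - D.coord u $ j"
        unfolding \<chi>[OF j] cuj[OF j] by (simp add: lam_def k_def algebra_simps)
      finally have "\<bar>g j - lam j * f j\<bar>\<^sup>2 \<le> (norm (D.coord t $ j - D.coord u $ j))\<^sup>2"
        by (rule power_mono) simp
      thus "(g j - lam j * f j)\<^sup>2 \<le> (norm (D.coord t $ j - D.coord u $ j))\<^sup>2" by simp
    qed
    also have "\<dots> = quad_form A (t - u)"
      using t u by (subst D.quad_form_A) (auto simp: D.coord_index_minus)
    also have "\<dots> \<le> \<gamma>\<^sup>2 * quad_form A u" by (rule ballA)
    also have "quad_form A u = (\<Sum>j<n. ((lam j - k) * f j)\<^sup>2)"
      unfolding D.quad_form_A[OF u]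
      by (intro sum.cong refl) (simp add: cuj f_def lam_def k_def power_mult_distrib)
    finally show ?thesis .
  qed
  have g_pos: "0 < (\<Sum>j<n. (g j)\<^sup>2)" by (rule ball_avoids_zero[OF \<gamma> k N(2) mean ball])
  define q where "q = (a - b) * (\<kappa> - b) / ((\<kappa> - b) + \<sigma>\<^sup>2 * (a - \<kappa>))"
  have ac: "a - c > 0" using order by linarith
  have \<sigma>_eq: "\<gamma> + (1-\<gamma>) * ((b-c)/(a-c)) = \<sigma>"
    using ac by (simp add: \<sigma>_def field_simps)
  have core: "0 \<le> (\<Sum>j<n. (lam j - ((b - c) + q)) * (g j)\<^sup>2)"
  proof -
    have "0 \<le> (\<Sum>j<n. (lam j - ((b-c) + ((a-c)-(b-c))*(k-(b-c))/((k-(b-c)) + (\<gamma> + (1-\<gamma>) * ((b-c)/(a-c)))\<^sup>2*((a-c)-k)))) * (g j)\<^sup>2)"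
      by (rule certificate_bound[OF \<gamma> _ _ _ _ mean ball])
        (use cb order c_le gap in \<open>auto simp: k_def lam_def\<close>)
    thus ?thesis unfolding \<sigma>_eq by (simp add: q_def k_def)
  qed
  have gx': "(\<Sum>j<n. (g j)\<^sup>2) = k\<^sup>2 * quad_form A x'"
    unfolding D.quad_form_A[OF x'] sum_distrib_left by (simp add: g_def \<chi>_def power_mult_distrib)
  have lx': "(\<Sum>j<n. l j * (g j)\<^sup>2) = k\<^sup>2 * quad_form B x'"
    unfolding D.quad_form_B[OF x'] sum_distrib_left by (simp add: g_def \<chi>_def power_mult_distrib mult_ac)
  have qA: "quad_form A x' > 0" using g_pos unfolding gx' using k by (simp add: zero_less_mult_iff)
  have "(\<Sum>j<n. (lam j - ((b - c) + q)) * (g j)\<^sup>2) = k\<^sup>2 * (quad_form B x' - (b + q) * quad_form A x')"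
  proof -
    have "(\<Sum>j<n. (lam j - ((b - c) + q)) * (g j)\<^sup>2) = (\<Sum>j<n. l j * (g j)\<^sup>2 - (b + q) * (g j)\<^sup>2)"
      by (intro sum.cong refl) (simp add: lam_def algebra_simps)
    also have "\<dots> = (\<Sum>j<n. l j * (g j)\<^sup>2) - (b + q) * (\<Sum>j<n. (g j)\<^sup>2)"
      by (simp add: sum_subtractf sum_distrib_left)
    finally show ?thesis unfolding gx' lx' by (simp add: algebra_simps)
  qed
  hence "0 \<le> quad_form B x' - (b + q) * quad_form A x'"
    using core k by (simp add: zero_le_mult_iff)
  hence Rq: "b + q \<le> rayleigh A B x'" using qA by (simp add: rayleigh_def pos_le_divide_eq)
  have \<sigma>1: "\<sigma>\<^sup>2 \<le> 1"
  proof -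
    have "0 \<le> (a-b)/(a-c)" "(a-b)/(a-c) \<le> 1" using ac cb order by auto
    hence "0 \<le> \<sigma>" "\<sigma> \<le> 1"
      using \<gamma> mult_le_one[of "1-\<gamma>" "(a-b)/(a-c)"] mult_nonneg_nonneg[of "1-\<gamma>" "(a-b)/(a-c)"]
      by (auto simp: \<sigma>_def)
    thus ?thesis by (simp add: power_le_one)
  qed
  have "x' \<noteq> 0\<^sub>v n"
  proof
    assume "x' = 0\<^sub>v n"
    hence "quad_form A x' = 0" using x' Ac by (simp add: quad_form_def)
    thus False using qA by simp
  qed
  thus ?thesis
    using ratio_bound[OF order(2,3) \<sigma>1 Rq[unfolded q_def]]
    by (simp add: Let_def x'_def a_def b_def c_def \<kappa>_def \<sigma>_def)
qed

section \<open>Sharpness of the convergence factor\<close>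

lemma quad_form_smult_mat:
  fixes M :: "'a::real_or_complex mat"
  assumes M: "M \<in> carrier_mat n n" and z: "z \<in> carrier_vec n"
  shows "quad_form (of_real c \<cdot>\<^sub>m M) z = c * quad_form M z"
proof -
  have Mz: "M *\<^sub>v z \<in> carrier_vec n" by (rule mult_mat_vec_carrier[OF M z])
  have "(of_real c \<cdot>\<^sub>m M) *\<^sub>v z = of_real c \<cdot>\<^sub>v (M *\<^sub>v z)"
    using M z by (intro eq_vecI) auto
  hence "z \<bullet>c ((of_real c \<cdot>\<^sub>m M) *\<^sub>v z) = c *\<^sub>R (z \<bullet>c (M *\<^sub>v z))"
    using Mz z by (simp add: conjugate_smult_vec conjugate_of_real scaleR_conv_of_real)
  thus ?thesis by (simp add: quad_form_def)
qed

lemma adjoint_mat_diag_real: "mat_adjoint (mat_diag n (\<lambda>i. of_real (l i) :: 'a::real_or_complex)) = mat_diag n (\<lambda>i. of_real (l i))"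
  by (rule eq_matI) (auto simp: mat_diag_def conjugate_of_real)

lemma adjoint_one: "mat_adjoint (1\<^sub>m n :: 'a::real_or_complex mat) = 1\<^sub>m n"
  by (rule eq_matI) auto

lemma pos_def_one: "pos_def_mat n (1\<^sub>m n :: 'a::real_or_complex mat)"
proof -
  have "0 < quad_form (1\<^sub>m n :: 'a mat) z" if z: "z \<in> carrier_vec n" "z \<noteq> 0\<^sub>v n" for z
  proof -
    obtain i where "i < n" "z $ i \<noteq> 0" using z by (auto simp: vec_eq_iff)
    thus ?thesis unfolding quad_form_one[OF z(1)] by (auto intro!: sum_pos2)
  qed
  thus ?thesis by (simp add: pos_def_mat_def hermitian_mat_def adjoint_one)
qed

text \<open>The extreme preconditioner that shrinks every correction as much as the hypothesis permits.\<close>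

lemma preconditioner_scalar:
  assumes "0 \<le> \<gamma>" "\<gamma> < 1"
  shows "preconditioner n \<gamma> (1\<^sub>m n) (of_real (1 - \<gamma>) \<cdot>\<^sub>m (1\<^sub>m n :: 'a::real_or_complex mat))"
proof -
  let ?T = "of_real (1 - \<gamma>) \<cdot>\<^sub>m (1\<^sub>m n :: 'a mat)"
  have one: "1\<^sub>m n \<in> carrier_mat n n" by simp
  have "mat_adjoint ?T = ?T" by (rule eq_matI) (auto simp: conjugate_of_real simp del: of_real_diff)
  hence T: "pos_def_mat n ?T"
    using pos_def_one[of n, where 'a='a] assms
    by (auto simp: pos_def_mat_def hermitian_mat_def quad_form_smult_mat[OF one] simp del: of_real_diff)
  obtain S where S: "mat_inverse ?T = Some S" "hermitian_mat n S" "S * ?T = 1\<^sub>m n"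
    by (rule pos_def_inverse[OF T])
  note Sc = hermitian_carrier[OF S(2)]
  have "of_real (1 - \<gamma>) \<cdot>\<^sub>m S = 1\<^sub>m n"
    using S(3) mult_smult_distrib[OF Sc one, of "of_real (1 - \<gamma>)"] Sc by simp
  hence eq: "(1 - \<gamma>) * quad_form S z = quad_form (1\<^sub>m n) z" if "z \<in> carrier_vec n" for z
    using quad_form_smult_mat[OF Sc that, of "1 - \<gamma>"] by simp
  have "quad_form (1\<^sub>m n) z \<le> (1 + \<gamma>) * quad_form S z" if z: "z \<in> carrier_vec n" for z
  proof -
    have "0 \<le> quad_form (1\<^sub>m n) z" unfolding quad_form_one[OF z] by (simp add: sum_nonneg)
    hence "0 \<le> quad_form S z" using eq[OF z] assms by (metis diff_gt_0_iff_gt zero_le_mult_iff not_less)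
    thus ?thesis unfolding eq[OF z, symmetric] using assms by (intro mult_right_mono) auto
  qed
  thus ?thesis unfolding preconditioner_def using T eq S(1) by auto
qed

text \<open>The square root of \<open>h\<close> is the ratio of the components of \<open>x\<close> along the eigenvectors for \<open>b\<close> and \<open>a\<close>. At
\<open>h = 0\<close> the inequality is the assumption \<open>\<tau> < \<sigma>\<close>, and it persists for small \<open>h > 0\<close> by continuity.\<close>

lemma step_parameter_exists:
  fixes a b c \<gamma> \<tau> :: real
  assumes "b < a" "c \<le> b" and \<tau>: "\<tau> < 1 - (1 - \<gamma>) * ((a - b) / (a - c))"
  obtains h where "0 < h" "\<tau> * (1 + (1 - \<gamma>) * (a - b) * h / (a - c + (b - c) * h))
      < 1 - (1 - \<gamma>) * (a - b) / (a - c + (b - c) * h)"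
proof -
  define F where "F = (\<lambda>h. 1 - (1 - \<gamma>) * (a - b) / (a - c + (b - c) * h)
      - \<tau> * (1 + (1 - \<gamma>) * (a - b) * h / (a - c + (b - c) * h)))"
  have "isCont F 0" unfolding F_def using assms by (intro continuous_intros) auto
  hence "(F \<longlongrightarrow> F 0) (at_right 0)" unfolding isCont_def by (rule tendsto_within_subset) simp
  moreover have "0 < F 0" using \<tau> by (simp add: F_def)
  ultimately have "eventually (\<lambda>h. 0 < F h) (at_right 0)" by (rule order_tendstoD)
  hence "eventually (\<lambda>h. 0 < F h \<and> 0 < h) (at_right 0)"
    using eventually_at_right_less[of 0] by (rule eventually_conj)
  then obtain h where "0 < F h" "0 < h" using eventually_happens[of _ "at_right (0::real)"] by fastforce
  thus thesis using that[of h] by (simp add: F_def)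
qed

definition real_vec3 :: "real \<Rightarrow> real \<Rightarrow> 'a::real_or_complex vec"
  where "real_vec3 p q = vec 3 (\<lambda>j. of_real ([p, q, 0] ! j))"

text \<open>The pencil of \<open>diag(a, b, c)\<close> and the identity, with \<open>x = (1, \<surd>h, 0)\<close>, serves for all cases; for
\<open>b = c\<close> the third coordinate merely repeats an eigenvalue. The step maps \<open>x\<close> to \<open>(p, \<surd>h v, 0)\<close>, so
the fraction changes from \<open>h\<close> to \<open>h (v / p)\<^sup>2\<close>, and \<open>h\<close> is chosen such that \<open>v / p > \<tau>\<close>.\<close>

theorem convergence_factor_sharp:
  fixes \<gamma> a b c \<tau> :: real
  assumes \<gamma>: "0 \<le> \<gamma>" "\<gamma> < 1" and ab: "a > b" and bc: "b \<ge> c"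
    and \<tau>: "0 \<le> \<tau>" "\<tau> < 1 - (1 - \<gamma>) * ((a - b) / (a - c))"
  shows "\<exists>n i (A :: 'a::real_or_complex mat) B T x.
           2 \<le> n \<and> 1 \<le> i \<and> i \<le> n - 1 \<and>
           pos_def_mat n A \<and> hermitian_mat n B \<and>
           pencil_eigval A B i = a \<and> pencil_eigval A B (i + 1) = b \<and> mu_min A B = c \<and>
           preconditioner n \<gamma> A T \<and>
           x \<in> carrier_vec n \<and> x \<noteq> 0\<^sub>v n \<and>
           pencil_eigval A B (i + 1) < rayleigh A B x \<and> rayleigh A B x \<le> pencil_eigval A B i \<and>
           (let x' = prec_step A B T x;
                \<mu> = pencil_eigval A B
            in \<not> (\<mu> i - rayleigh A B x') / (rayleigh A B x' - \<mu> (i + 1))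
                 \<le> \<tau>\<^sup>2 * ((\<mu> i - rayleigh A B x) / (rayleigh A B x - \<mu> (i + 1))))"
proof -
  define l where "l j = [a, b, c] ! j" for j :: nat
  define A :: "'a mat" where "A = 1\<^sub>m 3"
  define B :: "'a mat" where "B = mat_diag 3 (\<lambda>j. of_real (l j))"
  define T :: "'a mat" where "T = of_real (1 - \<gamma>) \<cdot>\<^sub>m 1\<^sub>m 3"
  have Bc: "B \<in> carrier_mat 3 3" by (simp add: B_def)
  interpret D: diagonalized_pencil 3 A B "1\<^sub>m 3" l
    by unfold_locales (simp_all add: A_def B_def adjoint_one left_mult_one_mat[OF mat_diag_dim]
        right_mult_one_mat[OF mat_diag_dim])
  have coord: "D.coord z = z" if "z \<in> carrier_vec 3" for z
    unfolding D.coord_def unfolding A_def adjoint_one using that by simp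
  have three: "{..<3::nat} = {0, 1, 2}" "[0..<3] = [0, 1, 2]" by (auto simp: numeral_eq_Suc)
  have "map l [0..<3] = [a, b, c]" by (simp add: three l_def)
  moreover have "sort [a, b, c] = [c, b, a]" using ab bc by auto
  ultimately have ev: "pencil_eigvals A B = [a, b, c]" by (simp add: D.eigvals)
  have \<mu>: "pencil_eigval A B 1 = a" "pencil_eigval A B (1 + 1) = b"
    by (simp_all add: pencil_eigval_def ev)
  have min: "mu_min A B = c"
    unfolding mu_min_def D.spectrum three using ab bc by (simp add: l_def)
  have ray: "rayleigh A B (real_vec3 p q) = (a * p\<^sup>2 + b * q\<^sup>2) / (p\<^sup>2 + q\<^sup>2)" for p q
  proof -
    have v: "real_vec3 p q \<in> carrier_vec 3" by (simp add: real_vec3_def)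
    show ?thesis
      unfolding rayleigh_def D.quad_form_A[OF v] D.quad_form_B[OF v] coord[OF v] three
      by (simp add: real_vec3_def l_def)
  qed
  obtain h where h: "0 < h" "\<tau> * (1 + (1 - \<gamma>) * (a - b) * h / (a - c + (b - c) * h))
      < 1 - (1 - \<gamma>) * (a - b) / (a - c + (b - c) * h)"
    by (rule step_parameter_exists[OF ab bc \<tau>(2)])
  define E where "E = a - c + (b - c) * h"
  have E: "E > 0" using ab bc h unfolding E_def by (intro add_pos_nonneg) auto
  define p where "p = 1 + (1 - \<gamma>) * (a - b) * h / E"
  define v where "v = 1 - (1 - \<gamma>) * (a - b) / E"
  have p: "p > 0" using \<gamma> ab h E unfolding p_def by (intro add_pos_nonneg) auto
  have vp: "\<tau> * p < v" using h(2) by (simp add: p_def v_def E_def)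
  define x :: "'a vec" where "x = real_vec3 1 (sqrt h)"
  define \<kappa> where "\<kappa> = (a + b * h) / (1 + h)"
  have rx: "rayleigh A B x = \<kappa>" using h by (simp add: x_def ray \<kappa>_def)
  have \<kappa>: "\<kappa> - c = E / (1 + h)" "a - \<kappa> = (a - b) * h / (1 + h)" "\<kappa> - b = (a - b) / (1 + h)"
    using h by (simp_all add: \<kappa>_def E_def field_simps)
  have pm: "1 + (1 - \<gamma>) / (\<kappa> - c) * (a - \<kappa>) = p" and vm: "1 + (1 - \<gamma>) / (\<kappa> - c) * (b - \<kappa>) = v"
  proof -
    have cancel: "g / (E / H) * (X / H) = g * X / E" if "H \<noteq> 0" for g H X :: real
      using that by simp
    have "1 + h \<noteq> 0" using h by simp
    note cancel = cancel[OF this]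
    have "(1 - \<gamma>) / (\<kappa> - c) * (a - \<kappa>) = (1 - \<gamma>) * (a - b) * h / E"
      "(1 - \<gamma>) / (\<kappa> - c) * (\<kappa> - b) = (1 - \<gamma>) * (a - b) / E"
      unfolding \<kappa> cancel by (simp_all only: mult.assoc)
    thus "1 + (1 - \<gamma>) / (\<kappa> - c) * (a - \<kappa>) = p" "1 + (1 - \<gamma>) / (\<kappa> - c) * (b - \<kappa>) = v"
      using mult_minus_right[of "(1 - \<gamma>) / (\<kappa> - c)" "\<kappa> - b"] unfolding p_def v_def
      by (simp_all only: minus_diff_eq add_uminus_conv_diff)
  qed
  have step: "prec_step A B T x = real_vec3 p (sqrt h * v)"
  proof (rule eq_vecI)
    fix j assume "j < dim_vec (real_vec3 p (sqrt h * v) :: 'a vec)"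
    hence j: "j < 3" by (simp add: real_vec3_def)
    define w where "w j = [1, sqrt h, 0] ! j" for j
    have xc: "x \<in> carrier_vec 3" and xj: "x $ j = of_real (w j)" using j by (simp_all add: x_def real_vec3_def w_def)
    define y where "y = B *\<^sub>v x - of_real \<kappa> \<cdot>\<^sub>v (A *\<^sub>v x)"
    have Bx: "B *\<^sub>v x \<in> carrier_vec 3" by (rule mult_mat_vec_carrier[OF Bc xc])
    have yc: "y \<in> carrier_vec 3" using Bx xc by (simp add: y_def A_def)
    have "(B *\<^sub>v x) $ j = of_real (l j) * of_real (w j)"
      unfolding B_def mat_diag_mult_vec_index[OF xc j] xj ..
    hence yj: "y $ j = of_real ((l j - \<kappa>) * w j)"
      using Bx xc xj j by (simp add: y_def A_def left_diff_distrib)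
    have "T *\<^sub>v y = of_real (1 - \<gamma>) \<cdot>\<^sub>v y"
      unfolding T_def using yc by (intro eq_vecI) auto
    hence "prec_step A B T x $ j = of_real (w j) + of_real (1 / (\<kappa> - c)) * (of_real (1 - \<gamma>) * of_real ((l j - \<kappa>) * w j))"
      using xc xj yc yj j by (simp add: prec_step_def rx min y_def[symmetric] del: of_real_diff of_real_mult of_real_divide)
    also have "\<dots> = of_real (w j * (1 + (1 - \<gamma>) / (\<kappa> - c) * (l j - \<kappa>)))"
      unfolding of_real_mult[symmetric] of_real_add[symmetric] by (simp only: of_real_eq_iff) (simp add: distrib_left mult_ac)
    also have "w j * (1 + (1 - \<gamma>) / (\<kappa> - c) * (l j - \<kappa>)) = [p, sqrt h * v, 0] ! j"
    proof -
      consider "j = 0" | "j = 1" | "j = 2" using j by linarith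
      thus ?thesis by cases (simp_all add: w_def l_def flip: pm vm)
    qed
    finally show "prec_step A B T x $ j = real_vec3 p (sqrt h * v) $ j"
      using j by (simp add: real_vec3_def)
  qed (simp add: prec_step_def real_vec3_def T_def)
  define R where "R = rayleigh A B (prec_step A B T x)"
  have R: "R = (a * p\<^sup>2 + b * (h * v\<^sup>2)) / (p\<^sup>2 + h * v\<^sup>2)"
    using h by (simp add: R_def step ray power_mult_distrib)
  have s: "p\<^sup>2 + h * v\<^sup>2 > 0" using p h by (intro add_pos_nonneg) auto
  have "a - R = (a - b) * (h * v\<^sup>2) / (p\<^sup>2 + h * v\<^sup>2)" "R - b = (a - b) * p\<^sup>2 / (p\<^sup>2 + h * v\<^sup>2)"
    unfolding R using s by (simp_all add: field_simps)
  hence ratio': "(a - R) / (R - b) = h * v\<^sup>2 / p\<^sup>2" using s ab by simp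
  have ratio: "(a - \<kappa>) / (\<kappa> - b) = h" unfolding \<kappa> using h ab by simp
  have "(\<tau> * p)\<^sup>2 < v\<^sup>2" using vp \<tau>(1) p by (intro power_strict_mono) auto
  hence "\<tau>\<^sup>2 * h < h * v\<^sup>2 / p\<^sup>2"
    using p h by (simp add: pos_less_divide_eq power_mult_distrib mult_ac)
  hence fails: "\<not> (a - R) / (R - b) \<le> \<tau>\<^sup>2 * ((a - \<kappa>) / (\<kappa> - b))" unfolding ratio ratio' by simp
  have x: "x \<in> carrier_vec 3" "x \<noteq> 0\<^sub>v 3"
  proof -
    show "x \<in> carrier_vec 3" by (simp add: x_def real_vec3_def)
    have "x $ 0 = 1" by (simp add: x_def real_vec3_def)
    thus "x \<noteq> 0\<^sub>v 3" by auto
  qed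
  have between: "b < \<kappa>" "\<kappa> \<le> a"
  proof -
    have "0 < (a - b) / (1 + h)" "0 \<le> (a - b) * h / (1 + h)" using ab h by auto
    thus "b < \<kappa>" "\<kappa> \<le> a" using \<kappa> by linarith+
  qed
  have "hermitian_mat 3 B" by (simp add: hermitian_mat_def B_def adjoint_mat_diag_real)
  moreover have "pos_def_mat 3 A" by (simp add: A_def pos_def_one)
  moreover have "preconditioner 3 \<gamma> A T" unfolding A_def T_def by (rule preconditioner_scalar[OF \<gamma>])
  ultimately show ?thesis
    using \<mu> min x between fails
    by (intro exI[of _ 3] exI[of _ 1] exI[of _ A] exI[of _ B] exI[of _ T] exI[of _ x])
      (simp add: Let_def rx R_def[symmetric])
qed

section \<open>The theorem over both fields\<close>

theorem theorem1p1:
  shows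
    "(\<forall>n \<gamma> (A :: real mat) B T x i.
        pos_def_mat n A \<and> hermitian_mat n B \<and>
        0 \<le> \<gamma> \<and> \<gamma> < 1 \<and> preconditioner n \<gamma> A T \<and>
        x \<in> carrier_vec n \<and> x \<noteq> 0\<^sub>v n \<and> mu_min A B < rayleigh A B x \<and>
        1 \<le> i \<and> i \<le> n - 1 \<and>
        pencil_eigval A B (i + 1) < rayleigh A B x \<and> rayleigh A B x \<le> pencil_eigval A B i
        \<longrightarrow>
        (let x' = prec_step A B T x;
             \<mu> = pencil_eigval A B;
             \<sigma> = 1 - (1 - \<gamma>) * ((\<mu> i - \<mu> (i + 1)) / (\<mu> i - mu_min A B))
         in x' \<noteq> 0\<^sub>v n \<and>
            rayleigh A B x' \<ge> rayleigh A B x \<and>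
            (\<mu> i - rayleigh A B x') / (rayleigh A B x' - \<mu> (i + 1))
              \<le> \<sigma>\<^sup>2 * ((\<mu> i - rayleigh A B x) / (rayleigh A B x - \<mu> (i + 1))))) \<and>
     (\<forall>n \<gamma> (A :: complex mat) B T x i.
        pos_def_mat n A \<and> hermitian_mat n B \<and>
        0 \<le> \<gamma> \<and> \<gamma> < 1 \<and> preconditioner n \<gamma> A T \<and>
        x \<in> carrier_vec n \<and> x \<noteq> 0\<^sub>v n \<and> mu_min A B < rayleigh A B x \<and>
        1 \<le> i \<and> i \<le> n - 1 \<and>
        pencil_eigval A B (i + 1) < rayleigh A B x \<and> rayleigh A B x \<le> pencil_eigval A B i
        \<longrightarrow>
        (let x' = prec_step A B T x;
             \<mu> = pencil_eigval A B;
             \<sigma> = 1 - (1 - \<gamma>) * ((\<mu> i - \<mu> (i + 1)) / (\<mu> i - mu_min A B))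
         in x' \<noteq> 0\<^sub>v n \<and>
            rayleigh A B x' \<ge> rayleigh A B x \<and>
            (\<mu> i - rayleigh A B x') / (rayleigh A B x' - \<mu> (i + 1))
              \<le> \<sigma>\<^sup>2 * ((\<mu> i - rayleigh A B x) / (rayleigh A B x - \<mu> (i + 1))))) \<and>
     (\<forall>\<gamma> a b c \<tau> :: real.
        0 \<le> \<gamma> \<and> \<gamma> < 1 \<and> a > b \<and> b \<ge> c \<and>
        0 \<le> \<tau> \<and> \<tau> < 1 - (1 - \<gamma>) * ((a - b) / (a - c))
        \<longrightarrow>
        (\<exists>n i (A :: real mat) B T x.
           2 \<le> n \<and> 1 \<le> i \<and> i \<le> n - 1 \<and>
           pos_def_mat n A \<and> hermitian_mat n B \<and>
           pencil_eigval A B i = a \<and> pencil_eigval A B (i + 1) = b \<and> mu_min A B = c \<and>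
           preconditioner n \<gamma> A T \<and>
           x \<in> carrier_vec n \<and> x \<noteq> 0\<^sub>v n \<and>
           pencil_eigval A B (i + 1) < rayleigh A B x \<and> rayleigh A B x \<le> pencil_eigval A B i \<and>
           (let x' = prec_step A B T x;
                \<mu> = pencil_eigval A B
            in \<not> (\<mu> i - rayleigh A B x') / (rayleigh A B x' - \<mu> (i + 1))
                 \<le> \<tau>\<^sup>2 * ((\<mu> i - rayleigh A B x) / (rayleigh A B x - \<mu> (i + 1)))))) \<and>
     (\<forall>\<gamma> a b c \<tau> :: real.
        0 \<le> \<gamma> \<and> \<gamma> < 1 \<and> a > b \<and> b \<ge> c \<and>
        0 \<le> \<tau> \<and> \<tau> < 1 - (1 - \<gamma>) * ((a - b) / (a - c))
        \<longrightarrow>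
        (\<exists>n i (A :: complex mat) B T x.
           2 \<le> n \<and> 1 \<le> i \<and> i \<le> n - 1 \<and>
           pos_def_mat n A \<and> hermitian_mat n B \<and>
           pencil_eigval A B i = a \<and> pencil_eigval A B (i + 1) = b \<and> mu_min A B = c \<and>
           preconditioner n \<gamma> A T \<and>
           x \<in> carrier_vec n \<and> x \<noteq> 0\<^sub>v n \<and>
           pencil_eigval A B (i + 1) < rayleigh A B x \<and> rayleigh A B x \<le> pencil_eigval A B i \<and>
           (let x' = prec_step A B T x;
                \<mu> = pencil_eigval A B
            in \<not> (\<mu> i - rayleigh A B x') / (rayleigh A B x' - \<mu> (i + 1))
                 \<le> \<tau>\<^sup>2 * ((\<mu> i - rayleigh A B x) / (rayleigh A B x - \<mu> (i + 1))))))"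
proof (intro conjI allI impI, goal_cases)
  case 1
  thus ?case by (elim conjE) (rule prec_step_contraction)
next
  case 2
  thus ?case by (elim conjE) (rule prec_step_contraction)
next
  case 3
  thus ?case by (elim conjE) (rule convergence_factor_sharp)
next
  case 4
  thus ?case by (elim conjE) (rule convergence_factor_sharp)
qed

end
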